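(* Let $k_1=(\rho-\tilde\rho)q$, $k_2=k_Iq\,(1+l_1(1)\lambda(1))$ and $\tau=\int_0^1\big(\frac1{\lambda(\xi)}+\frac1{\mu(\xi)}\big)d\xi$. Suppose $k_I$ is chosen such that $|k_1|<1$, $k_2<0$ and $\tau\in(0,\tau_0)$, where $\tau_0$ is the number depending on $k_1,k_2$ defined in the context. Then the neutral differential equation $$\dot z(t)=k_1\,\dot z(t-\tau)+k_2\,z(t-\tau)+K(t),\qquad t\ge\tau,$$ for $z(t)=\overline\alpha(t,1)$, is Input-to-State Stable with respect to the input $K$: there exist a $\mathcal{KL}$ function $f$ and a $\mathcal{K}$ function $g$ such that, for any bounded initial state $(\overline\alpha^0,\overline\beta^0)$ and any measurable locally essentially bounded input $K$, the solution exists for all $t\ge 0$ and satisfies $$|z(t)|\le f\big(\|\overline\alpha^0\|_\infty+\|\overline\beta^0\|_\infty,\,t\big)+g\big(\|K\|_{L^\infty((0,t);\mathbb{R})}\big)\qquad\text{for all }t\ge0 .$$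
   Context: Standing assumptions. $\lambda,\mu:[0,1]\to\mathbb{R}$ are Lipschitz-continuous with $\lambda(x),\mu(x)>0$ for all $x$; $\gamma_1,\gamma_2\in C^1([0,1];\mathbb{R})$; $q\ne0$ and $\rho$ are constants with $\rho q<1$; $\tilde\rho$ is a constant with $|\rho q|+|\tilde\rho q|<1$; $k_I\in\mathbb{R}$. Meaning of initial state and solution. The initial state is a pair of bounded measurable functions $\overline\alpha^0,\overline\beta^0:[0,1]\to\mathbb{R}$ with sup norms $\|\cdot\|_\infty$. With $\phi_1(x)=\int_0^x\frac{d\xi}{\lambda(\xi)}$, $\phi_2(x)=\int_0^x\frac{d\xi}{\mu(\xi)}$, $\tau_1=\phi_1(1)$, it determines the initial history of $z$ on $[0,\tau]$ by transport along characteristics ($\overline\alpha_t+\lambda\overline\alpha_x=0$, $\overline\beta_t-\mu\overline\beta_x=0$, $\overline\alpha(t,0)=q\overline\beta(t,0)$): $z(t)=\overline\alpha^0(\phi_1^{-1}(\tau_1-t))$ for $0\le t<\tau_1$ and $z(t)=q\,\overline\beta^0(\phi_2^{-1}(t-\tau_1))$ for $\tau_1\le t\le\tau$. A solution is a function $z$ on $[0,\infty)$ with this history such that $t\mapsto z(t)-k_1z(t-\tau)$ is locally absolutely continuous on $[\tau,\infty)$ with derivative $k_2z(t-\tau)+K(t)$ for almost every $t\ge\tau$. A class $\mathcal{K}$ function is a continuous strictly increasing $g:[0,\infty)\to[0,\infty)$ with $g(0)=0$; a class $\mathcal{KL}$ function $f(r,t)$ is class $\mathcal{K}$ in $r$ for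 each $t$ and decreasing to $0$ as $t\to\infty$ for each $r$. Kernels. On $\mathcal{T}=\{(x,\xi)\in[0,1]^2:\xi\le x\}$, the bounded kernels $K^{uu},K^{uv},K^{vu},K^{vv}$ are the solution (along characteristics) of $\lambda(x)\partial_xK^{uu}+\partial_\xi(\lambda(\xi)K^{uu})=-\gamma_2(\xi)K^{uv}$, $\lambda(x)\partial_xK^{uv}-\partial_\xi(\mu(\xi)K^{uv})=-\gamma_1(\xi)K^{uu}$, $\mu(x)\partial_xK^{vu}-\partial_\xi(\lambda(\xi)K^{vu})=\gamma_2(\xi)K^{vv}$, $\mu(x)\partial_xK^{vv}+\partial_\xi(\mu(\xi)K^{vv})=\gamma_1(\xi)K^{vu}$, with $K^{uv}(x,x)=\frac{\gamma_1(x)}{\lambda(x)+\mu(x)}$, $K^{vu}(x,x)=-\frac{\gamma_2(x)}{\lambda(x)+\mu(x)}$, $K^{uv}(x,0)=\frac{q\lambda(0)}{\mu(0)}K^{uu}(x,0)$, $K^{vv}(x,0)=\frac{q\lambda(0)}{\mu(0)}K^{vu}(x,0)$. The Volterra transformation $\alpha(x)=u(x)-\int_0^x(K^{uu}(x,\xi)u(\xi)+K^{uv}(x,\xi)v(\xi))d\xi$, $\beta(x)=v(x)-\int_0^x(K^{vu}(x,\xi)u(\xi)+K^{vv}(x,\xi)v(\xi))d\xi$ is invertible with inverse $u(x)=\alpha(x)+\int_0^x(L^{\alpha\alpha}(x,\xi)\alpha(\xi)+L^{\alpha\beta}(x,\xi)\beta(\xi))d\xi$, $v(x)=\beta(x)+\int_0^x(L^{\beta\alpha}(x,\xi)\alpha(\xi)+L^{\beta\beta}(x,\xi)\beta(\xi))d\xi$,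 the $L$ kernels being in $L^\infty(\mathcal{T})$. It is assumed that $1+\int_0^1L^{\alpha\alpha}(1,\xi)d\xi+\frac1q\int_0^1L^{\alpha\beta}(1,\xi)d\xi\ne0$. Functions $l_1,l_2$ on $[0,1]$ are the solution of $(l_1\lambda)'(x)=L^{\alpha\alpha}(1,x)$, $(l_2\mu)'(x)=-L^{\alpha\beta}(1,x)$, $l_2(1)=0$, $l_1(0)=\frac{\mu(0)}{q\lambda(0)}l_2(0)$. Threshold $\tau_0$ (for $|k_1|<1$, $k_2<0$): $\tau_0=\frac{\sqrt{1-k_1^2}}{|k_2|}\Big(\pi-\arctan\frac{\sqrt{1-k_1^2}}{|k_1|}\Big)$ if $k_1\in(-1,0)$; $\tau_0=\frac{\pi}{2|k_2|}$ if $k_1=0$; $\tau_0=\frac{\sqrt{1-k_1^2}}{|k_2|}\arctan\frac{\sqrt{1-k_1^2}}{k_1}$ if $k_1\in(0,1)$. *)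

theory Defs
  imports "HOL-Probability.Essential_Supremum"
begin

section \<open>Function classes\<close>

definition bounded_measurable_on :: "'a::euclidean_space set \<Rightarrow> ('a \<Rightarrow> real) \<Rightarrow> bool" where
  "bounded_measurable_on S f \<longleftrightarrow> f \<in> borel_measurable (lebesgue_on S) \<and> bounded (f ` S)"

text \<open>Working in \<^typ>\<open>ennreal\<close> makes the essential supremum over a null set \<open>0\<close>.\<close>

definition in_Linfty :: "'a::euclidean_space set \<Rightarrow> ('a \<Rightarrow> real) \<Rightarrow> bool" where
  "in_Linfty S f \<longleftrightarrow> f \<in> borel_measurable (lebesgue_on S)
     \<and> esssup (lebesgue_on S) (\<lambda>x. ennreal \<bar>f x\<bar>) < \<infinity>"

definition Linfty_norm :: "'a::euclidean_space set \<Rightarrow> ('a \<Rightarrow> real) \<Rightarrow> real" where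
  "Linfty_norm S f = enn2real (esssup (lebesgue_on S) (\<lambda>x. ennreal \<bar>f x\<bar>))"

definition sup_norm :: "(real \<Rightarrow> real) \<Rightarrow> real" where
  "sup_norm f = (SUP x\<in>{0..1}. \<bar>f x\<bar>)"

definition C1_unit :: "(real \<Rightarrow> real) \<Rightarrow> bool" where
  "C1_unit f \<longleftrightarrow> (\<exists>f'. continuous_on {0..1} f'
     \<and> (\<forall>x\<in>{0..1}. (f has_real_derivative f' x) (at x within {0..1})))"

text \<open>The members of a division are non-overlapping compact intervals \<open>{a..b}\<close>, so that \<open>Inf k\<close>
  and \<open>Sup k\<close> are the end points of \<open>k\<close>.\<close>

definition abs_continuous_on :: "real set \<Rightarrow> (real \<Rightarrow> real) \<Rightarrow> bool" where
  "abs_continuous_on S h \<longleftrightarrow> (\<forall>\<epsilon>>0. \<exists>\<delta>>0. \<forall>d T. d division_of T \<and> T \<subseteq> S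
     \<and> (\<Sum>k\<in>d. Sup k - Inf k) < \<delta> \<longrightarrow> (\<Sum>k\<in>d. \<bar>h (Sup k) - h (Inf k)\<bar>) < \<epsilon>)"

definition loc_ac_with_derivative :: "real set \<Rightarrow> (real \<Rightarrow> real) \<Rightarrow> (real \<Rightarrow> real) \<Rightarrow> bool" where
  "loc_ac_with_derivative S h g \<longleftrightarrow> (\<forall>a b. {a..b} \<subseteq> S \<longrightarrow> abs_continuous_on {a..b} h)
     \<and> (AE t in lebesgue_on S. (h has_real_derivative g t) (at t within S))"

text \<open>Functions on \<open>[0,\<infinity>)\<close> are represented by functions on \<^typ>\<open>real\<close> whose values at negative
  arguments are irrelevant. Nonnegativity on \<open>[0,\<infinity>)\<close> follows from the clauses below.\<close>

definition class_K :: "(real \<Rightarrow> real) \<Rightarrow> bool" where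
  "class_K g \<longleftrightarrow> continuous_on {0..} g \<and> strict_mono_on {0..} g \<and> g 0 = 0"

text \<open>``Decreasing'' in the second argument is not meant strictly: \<open>f 0\<close> vanishes on \<open>[0,\<infinity>)\<close>.\<close>

definition class_KL :: "(real \<Rightarrow> real \<Rightarrow> real) \<Rightarrow> bool" where
  "class_KL f \<longleftrightarrow> (\<forall>t\<ge>0. class_K (\<lambda>r. f r t))
     \<and> (\<forall>r\<ge>0. antimono_on {0..} (f r) \<and> (f r \<longlongrightarrow> 0) at_top)"

section \<open>Kernels\<close>

definition kernel_triangle :: "(real \<times> real) set" where
  "kernel_triangle = {(x, \<xi>). x \<in> {0..1} \<and> \<xi> \<in> {0..1} \<and> \<xi> \<le> x}"

definition characteristic_curve ::
  "(real \<Rightarrow> real) \<Rightarrow> (real \<Rightarrow> real) \<Rightarrow> real \<Rightarrow> real \<Rightarrow> (real \<Rightarrow> real) \<Rightarrow> (real \<Rightarrow> real) \<Rightarrow> bool" where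
  "characteristic_curve a c s0 s1 x \<xi> \<longleftrightarrow> (\<forall>s\<in>{s0..s1}. (x s, \<xi> s) \<in> kernel_triangle
     \<and> (x has_real_derivative a (x s)) (at s within {s0..s1})
     \<and> (\<xi> has_real_derivative c (\<xi> s)) (at s within {s0..s1}))"

text \<open>Solution along characteristics of \<open>a(x) \<partial>\<^sub>x k + \<partial>\<^sub>\<xi> (c(\<xi>) k) = r\<close> on the triangle. Since \<open>c\<close> is
  merely Lipschitz, the product \<open>c(\<xi>) k\<close> is not expanded; instead the equation is multiplied by
  \<open>c(\<xi>)\<close>, so that \<open>m = c(\<xi>) k\<close> satisfies \<open>a(x) \<partial>\<^sub>x m + c(\<xi>) \<partial>\<^sub>\<xi> m = c(\<xi>) r\<close>, whose left-hand side is
  the derivative of \<open>m\<close> along the curves \<open>x' = a(x)\<close>, \<open>\<xi>' = c(\<xi>)\<close>.\<close>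

definition solves_along_characteristics ::
  "(real \<Rightarrow> real) \<Rightarrow> (real \<Rightarrow> real) \<Rightarrow> (real \<times> real \<Rightarrow> real) \<Rightarrow> (real \<times> real \<Rightarrow> real) \<Rightarrow> bool" where
  "solves_along_characteristics a c k r \<longleftrightarrow> (\<forall>s0 s1 x \<xi>. characteristic_curve a c s0 s1 x \<xi> \<longrightarrow>
     loc_ac_with_derivative {s0..s1} (\<lambda>s. c (\<xi> s) * k (x s, \<xi> s)) (\<lambda>s. c (\<xi> s) * r (x s, \<xi> s)))"

definition backstepping_kernels ::
  "(real \<Rightarrow> real) \<Rightarrow> (real \<Rightarrow> real) \<Rightarrow> (real \<Rightarrow> real) \<Rightarrow> (real \<Rightarrow> real) \<Rightarrow> real \<Rightarrow>
   (real \<times> real \<Rightarrow> real) \<Rightarrow> (real \<times> real \<Rightarrow> real) \<Rightarrow> (real \<times> real \<Rightarrow> real) \<Rightarrow> (real \<times> real \<Rightarrow> real) \<Rightarrow> bool"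
where
  "backstepping_kernels lam mu gam1 gam2 q Kuu Kuv Kvu Kvv \<longleftrightarrow>
     bounded_measurable_on kernel_triangle Kuu \<and> bounded_measurable_on kernel_triangle Kuv \<and>
     bounded_measurable_on kernel_triangle Kvu \<and> bounded_measurable_on kernel_triangle Kvv \<and>
     solves_along_characteristics lam lam Kuu (\<lambda>(x, \<xi>). - gam2 \<xi> * Kuv (x, \<xi>)) \<and>
     solves_along_characteristics lam (\<lambda>\<xi>. - mu \<xi>) Kuv (\<lambda>(x, \<xi>). - gam1 \<xi> * Kuu (x, \<xi>)) \<and>
     solves_along_characteristics mu (\<lambda>\<xi>. - lam \<xi>) Kvu (\<lambda>(x, \<xi>). gam2 \<xi> * Kvv (x, \<xi>)) \<and>
     solves_along_characteristics mu mu Kvv (\<lambda>(x, \<xi>). gam1 \<xi> * Kvu (x, \<xi>)) \<and>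
     (\<forall>x\<in>{0..1}. Kuv (x, x) = gam1 x / (lam x + mu x)
       \<and> Kvu (x, x) = - (gam2 x / (lam x + mu x))
       \<and> Kuv (x, 0) = q * lam 0 / mu 0 * Kuu (x, 0)
       \<and> Kvv (x, 0) = q * lam 0 / mu 0 * Kvu (x, 0))"

definition volterra_term ::
  "(real \<times> real \<Rightarrow> real) \<Rightarrow> (real \<times> real \<Rightarrow> real) \<Rightarrow> (real \<Rightarrow> real) \<Rightarrow> (real \<Rightarrow> real) \<Rightarrow> real \<Rightarrow> real" where
  "volterra_term A B f g x = integral {0..x} (\<lambda>\<xi>. A (x, \<xi>) * f \<xi> + B (x, \<xi>) * g \<xi>)"

text \<open>The values of an \<open>L\<^sup>\<infinity>\<close> kernel on the null set \<open>x = 1\<close> are used later on. They are meaningful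
  because every section is required to be in \<open>L\<^sup>\<infinity>\<close> and the inversion formula is required at every \<open>x\<close>,
  which determines every section almost everywhere.\<close>

definition Linfty_kernel :: "(real \<times> real \<Rightarrow> real) \<Rightarrow> bool" where
  "Linfty_kernel L \<longleftrightarrow> in_Linfty kernel_triangle L
     \<and> (\<forall>x\<in>{0..1}. in_Linfty {0..x} (\<lambda>\<xi>. L (x, \<xi>)))"

definition inverse_kernels ::
  "(real \<times> real \<Rightarrow> real) \<Rightarrow> (real \<times> real \<Rightarrow> real) \<Rightarrow> (real \<times> real \<Rightarrow> real) \<Rightarrow> (real \<times> real \<Rightarrow> real) \<Rightarrow>
   (real \<times> real \<Rightarrow> real) \<Rightarrow> (real \<times> real \<Rightarrow> real) \<Rightarrow> (real \<times> real \<Rightarrow> real) \<Rightarrow> (real \<times> real \<Rightarrow> real) \<Rightarrow> bool"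
where
  "inverse_kernels Kuu Kuv Kvu Kvv Laa Lab Lba Lbb \<longleftrightarrow>
     Linfty_kernel Laa \<and> Linfty_kernel Lab \<and> Linfty_kernel Lba \<and> Linfty_kernel Lbb \<and>
     (\<forall>u v a b. bounded_measurable_on {0..1} u \<and> bounded_measurable_on {0..1} v \<and>
        bounded_measurable_on {0..1} a \<and> bounded_measurable_on {0..1} b \<longrightarrow>
        ((\<forall>x\<in>{0..1}. a x = u x - volterra_term Kuu Kuv u v x \<and> b x = v x - volterra_term Kvu Kvv u v x)
         \<longleftrightarrow>
         (\<forall>x\<in>{0..1}. u x = a x + volterra_term Laa Lab a b x \<and> v x = b x + volterra_term Lba Lbb a b x)))"

definition l_functions ::
  "(real \<Rightarrow> real) \<Rightarrow> (real \<Rightarrow> real) \<Rightarrow> real \<Rightarrow> (real \<times> real \<Rightarrow> real) \<Rightarrow> (real \<times> real \<Rightarrow> real) \<Rightarrow>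
   (real \<Rightarrow> real) \<Rightarrow> (real \<Rightarrow> real) \<Rightarrow> bool" where
  "l_functions lam mu q Laa Lab l1 l2 \<longleftrightarrow>
     loc_ac_with_derivative {0..1} (\<lambda>x. l1 x * lam x) (\<lambda>x. Laa (1, x)) \<and>
     loc_ac_with_derivative {0..1} (\<lambda>x. l2 x * mu x) (\<lambda>x. - Lab (1, x)) \<and>
     l2 1 = 0 \<and> l1 0 = mu 0 / (q * lam 0) * l2 0"

section \<open>The neutral equation\<close>

definition travel_time :: "(real \<Rightarrow> real) \<Rightarrow> real \<Rightarrow> real" where
  "travel_time c x = integral {0..x} (\<lambda>\<xi>. 1 / c \<xi>)"

definition initial_history ::
  "(real \<Rightarrow> real) \<Rightarrow> (real \<Rightarrow> real) \<Rightarrow> real \<Rightarrow> (real \<Rightarrow> real) \<Rightarrow> (real \<Rightarrow> real) \<Rightarrow> real \<Rightarrow> real" where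
  "initial_history lam mu q \<alpha>0 \<beta>0 t =
     (let \<tau>1 = travel_time lam 1 in
      if t < \<tau>1 then \<alpha>0 (the_inv_into {0..1} (travel_time lam) (\<tau>1 - t))
      else q * \<beta>0 (the_inv_into {0..1} (travel_time mu) (t - \<tau>1)))"

definition neutral_solution ::
  "real \<Rightarrow> real \<Rightarrow> real \<Rightarrow> (real \<Rightarrow> real) \<Rightarrow> (real \<Rightarrow> real) \<Rightarrow> (real \<Rightarrow> real) \<Rightarrow> bool" where
  "neutral_solution k1 k2 \<tau> h K z \<longleftrightarrow>
     (\<forall>t\<in>{0..\<tau>}. z t = h t) \<and>
     loc_ac_with_derivative {\<tau>..} (\<lambda>t. z t - k1 * z (t - \<tau>)) (\<lambda>t. k2 * z (t - \<tau>) + K t)"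

definition tau0 :: "real \<Rightarrow> real \<Rightarrow> real" where
  "tau0 k1 k2 =
     (if k1 < 0 then sqrt (1 - k1\<^sup>2) / \<bar>k2\<bar> * (pi - arctan (sqrt (1 - k1\<^sup>2) / \<bar>k1\<bar>))
      else if k1 = 0 then pi / (2 * \<bar>k2\<bar>)
      else sqrt (1 - k1\<^sup>2) / \<bar>k2\<bar> * arctan (sqrt (1 - k1\<^sup>2) / k1))"

end

theory Submission
  imports Defs "HOL-Complex_Analysis.Complex_Analysis"
begin

text \<open>Integrated once, the equation says that \<open>z t - k1 z (t - \<tau>)\<close> is a constant plus
\<open>k2 \<integral> z + \<integral> K\<close>, so it can be solved by the method of steps on successive intervals of length \<open>\<tau>\<close>. Two
solutions coincide because the difference of the corresponding absolutely continuous functions has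
derivative zero almost everywhere (\<open>abs_continuous_zero_derivative_constant\<close>).

For the estimate, regard the solution as a sequence of functions \<open>y n\<close> on \<open>[0, \<tau>]\<close>, one for each block
of length \<open>\<tau>\<close>. Apart from the effect of the starting values \<open>p n = y n 0\<close>, a block arises from the
previous one by the operator \<open>f \<mapsto> k1 f + k2 \<integral> f\<close>, which is a contraction in a weighted supremum norm since
\<open>\<bar>k1\<bar> < 1\<close>. Instability can thus only come from the scalar sequence \<open>p\<close>, which satisfies a discrete
renewal equation \<open>p (n + 1) = (\<Sum>m\<le>n. c (n - m) * p m) + d (n + 1)\<close>. The generating function of its kernel
is \<open>\<Sum> c n \<zeta>\<^sup>n = exp (\<zeta> k2 \<tau> / (1 - \<zeta> k1))\<close> (\<open>pulse_response_generating_function\<close>), and \<open>1 - \<zeta> \<Sum> c n \<zeta>\<^sup>n\<close>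
vanishes at \<open>\<zeta>\<close> exactly if \<open>\<zeta> = exp (- s \<tau>)\<close> for the characteristic root \<open>s = \<zeta> k2 / (1 - \<zeta> k1)\<close> of
the neutral equation.

The threshold for \<open>\<tau>\<close> is the delay at which the first characteristic roots reach the imaginary axis.
Below it there is no root in the closed right half-plane, as a direct estimate of the characteristic
equation shows (\<open>no_root_closed_right_half_plane\<close>), hence \<open>1 - \<zeta> \<Sum> c n \<zeta>\<^sup>n\<close> has no zero in the closed unit
disc and, by compactness, none in a slightly larger disc. The Taylor coefficients of its reciprocal
decay exponentially (\<open>renewal_exponential_bound\<close>). So \<open>p\<close>, and with it \<open>z\<close>, is bounded by a
constant times \<open>exp (- \<sigma> t)\<close> times the size of the initial state plus a constant times the size of the
input (\<open>neutral_exponential_bound\<close>): the class KL function is exponential in time and linear in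
the state, and the class K function is linear.\<close>

section \<open>Roots of the characteristic equation\<close>

lemma mult_cos_le_sin:
  fixes h :: real
  assumes "0 \<le> h" "h \<le> pi"
  shows "h * cos h \<le> sin h"
proof -
  have "(\<lambda>x. sin x - x * cos x) 0 \<le> (\<lambda>x. sin x - x * cos x) h"
  proof (rule DERIV_nonneg_imp_nondecreasing[OF assms(1)])
    fix x assume "0 \<le> x" "x \<le> h"
    then have "0 \<le> x * sin x"
      using assms by (intro mult_nonneg_nonneg sin_ge_zero) auto
    moreover have "((\<lambda>x. sin x - x * cos x) has_real_derivative x * sin x) (at x)"
      by (auto intro!: derivative_eq_intros)
    ultimately show "\<exists>y. ((\<lambda>x. sin x - x * cos x) has_real_derivative y) (at x) \<and> 0 \<le> y"
      by blast
  qed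
  then show ?thesis by simp
qed

text \<open>The derivative \<open>sin \<phi> + \<phi> cos \<phi>\<close> of \<open>\<phi> sin \<phi>\<close> is strictly decreasing on \<open>[\<pi>/2, \<pi>]\<close>, so once it is
nonpositive, as \<open>past\<close> says, the function decreases on the rest of the interval. The addition
theorem together with \<open>h cos h \<le> sin h\<close> makes this an algebraic estimate.\<close>

lemma mult_sin_decreasing_past_maximum:
  fixes \<phi> \<psi> :: real
  assumes \<phi>: "pi / 2 \<le> \<phi>" "\<phi> \<le> \<psi>" "\<psi> \<le> pi" and past: "sin \<phi> \<le> - \<phi> * cos \<phi>"
  shows "\<psi> * sin \<psi> \<le> \<phi> * sin \<phi>"
proof -
  define h where "h = \<psi> - \<phi>"
  have h: "0 \<le> h" "h \<le> pi / 2" and "\<phi> > 0"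
    using \<phi> pi_gt_zero unfolding h_def by linarith+
  have sin_phi: "0 \<le> sin \<phi>" and "0 \<le> cos h" and "0 \<le> sin h"
    using \<phi> h \<open>\<phi> > 0\<close> by (auto intro!: sin_ge_zero cos_ge_zero)
  have "h * cos h \<le> sin h"
    using h pi_gt_zero by (intro mult_cos_le_sin) linarith+
  have "\<phi> * sin \<psi> = \<phi> * (sin \<phi> * cos h + cos \<phi> * sin h)"
    unfolding sin_add[symmetric] h_def by simp
  also have "\<dots> = \<phi> * sin \<phi> * cos h + (\<phi> * cos \<phi>) * sin h"
    by (simp add: algebra_simps)
  also have "\<dots> \<le> \<phi> * sin \<phi> * cos h + (- sin \<phi>) * sin h"
    using past \<open>0 \<le> sin h\<close> by (intro add_left_mono mult_right_mono) auto
  also have "\<dots> \<le> \<phi> * sin \<phi> * cos h - sin \<phi> * (h * cos h)"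
    using mult_left_mono[OF \<open>h * cos h \<le> sin h\<close> sin_phi] by simp
  also have "\<dots> = sin \<phi> * cos h * (\<phi> - h)"
    by (simp add: algebra_simps)
  finally have "\<psi> * (\<phi> * sin \<psi>) \<le> \<psi> * (sin \<phi> * cos h * (\<phi> - h))"
    using \<phi> \<open>\<phi> > 0\<close> by (intro mult_left_mono) auto
  also have "\<dots> = (sin \<phi> * cos h) * (\<phi>\<^sup>2 - h\<^sup>2)"
    unfolding h_def by (simp add: algebra_simps power2_eq_square)
  also have "\<dots> \<le> (sin \<phi> * cos h) * \<phi>\<^sup>2"
    using sin_phi \<open>0 \<le> cos h\<close> by (intro mult_left_mono) auto
  also have "\<dots> \<le> (sin \<phi> * 1) * \<phi>\<^sup>2"
    using sin_phi by (intro mult_right_mono mult_left_mono) auto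
  finally have "\<phi> * (\<psi> * sin \<psi>) \<le> \<phi> * (\<phi> * sin \<phi>)"
    by (simp add: algebra_simps power2_eq_square)
  then show ?thesis using \<open>\<phi> > 0\<close> by simp
qed

text \<open>With \<open>S = X + i\<phi>\<close>, the hypotheses \<open>re\<close> and \<open>im\<close> are the two parts of \<open>S exp S = k S - c\<close>, the
characteristic equation of \<open>\<dot>z(t) = k \<dot>z(t - 1) - c z(t - 1)\<close>. On the imaginary axis the first root
appears at the angle \<open>\<phi>0 = arccos k\<close>, for \<open>c = \<phi>0 sin \<phi>0\<close>. Every root with \<open>X \<ge> 0\<close> and \<open>\<phi> > 0\<close> forces
\<open>c\<close> to be at least as large, for two different reasons:

\<^item> if \<open>\<phi> \<ge> \<phi>0\<close>, the squared modulus of the equation,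
  \<open>c\<^sup>2 - 2 k c X = (X\<^sup>2 + \<phi>\<^sup>2) (exp (2 X) - k\<^sup>2)\<close>, cannot balance for smaller \<open>c\<close>;

\<^item> if \<open>\<phi> < \<phi>0\<close>, then \<open>k < cos \<phi> < 0\<close>, the imaginary part is solvable only beyond the maximum of
  \<open>\<phi> sin \<phi>\<close>, and there \<open>c \<ge> \<phi> sin \<phi> \<ge> \<phi>0 sin \<phi>0\<close>.\<close>

lemma no_root_upper_half_plane:
  fixes X \<phi> c k :: real
  assumes X: "0 \<le> X" and \<phi>: "0 < \<phi>" and c: "0 < c" "c < sqrt (1 - k\<^sup>2) * arccos k" and k: "\<bar>k\<bar> < 1"
    and re: "exp X * (X * cos \<phi> - \<phi> * sin \<phi>) = k * X - c"
    and im: "exp X * (X * sin \<phi> + \<phi> * cos \<phi>) = k * \<phi>"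
  shows False
proof -
  define \<phi>0 where "\<phi>0 = arccos k"
  define E where "E = exp X"
  define C where "C = E * cos \<phi> - k"
  define S where "S = E * sin \<phi>"
  have re': "X * C - \<phi> * S = - c" and im': "\<phi> * C = - (X * S)"
    using re im unfolding C_def S_def E_def by (simp_all add: algebra_simps)
  have E: "1 \<le> E" "1 + X \<le> E" "E > 0"
    using X unfolding E_def by (auto simp: exp_ge_add_one_self)
  have k2: "0 < 1 - k\<^sup>2"
    using k by (simp add: abs_square_less_1)
  have \<phi>0: "0 < \<phi>0" "\<phi>0 < pi" "cos \<phi>0 = k" "sin \<phi>0 = sqrt (1 - k\<^sup>2)"
    using k arccos_lt_bounded[of k] unfolding \<phi>0_def by (auto simp: sin_arccos)
  have "\<phi> * (X * C - \<phi> * S) = - c * \<phi>" by (simp add: re')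
  then have "X * (\<phi> * C) - \<phi>\<^sup>2 * S = - c * \<phi>"
    by (simp add: algebra_simps power2_eq_square)
  then have cphi: "c * \<phi> = S * (X\<^sup>2 + \<phi>\<^sup>2)"
    unfolding im' by (simp add: algebra_simps power2_eq_square)
  have "X * (X * C - \<phi> * S) + \<phi> * (\<phi> * C) = - c * X + \<phi> * (- (X * S))"
    unfolding re' im' by simp
  then have cX: "c * X = - C * (X\<^sup>2 + \<phi>\<^sup>2)"
    by (simp add: algebra_simps power2_eq_square)
  have pos: "0 < X\<^sup>2 + \<phi>\<^sup>2" using \<phi> by (simp add: add_nonneg_pos)
  have "0 \<le> - C * (X\<^sup>2 + \<phi>\<^sup>2)" unfolding cX[symmetric] using c X by simp
  then have C: "C \<le> 0"
    using pos by (metis neg_0_le_iff_le mult_le_cancel_right_pos mult_zero_left)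
  have "c\<^sup>2 = (X * C - \<phi> * S)\<^sup>2 + (\<phi> * C + X * S)\<^sup>2"
    using re' im' by simp
  also have "\<dots> = (X\<^sup>2 + \<phi>\<^sup>2) * (C\<^sup>2 + S\<^sup>2)"
    by (simp add: algebra_simps power2_eq_square)
  also have "C\<^sup>2 + S\<^sup>2 = (E\<^sup>2 * (cos \<phi>)\<^sup>2 + E\<^sup>2 * (sin \<phi>)\<^sup>2) - k\<^sup>2 - 2 * k * C"
    unfolding C_def S_def by (simp add: algebra_simps power2_eq_square)
  also have "\<dots> = E\<^sup>2 - k\<^sup>2 - 2 * k * C"
    by (simp flip: distrib_left)
  finally have csq: "c\<^sup>2 = (X\<^sup>2 + \<phi>\<^sup>2) * (E\<^sup>2 - k\<^sup>2) + 2 * k * (c * X)"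
    unfolding cX by (simp add: algebra_simps)
  show False
  proof (cases "\<phi>0 \<le> \<phi>")
    case True
    have "- k * c \<le> \<phi>0\<^sup>2"
    proof (cases "k \<ge> 0")
      case True
      then have "- k * c \<le> 0" using c by simp
      then show ?thesis by (rule order_trans) simp
    next
      case False
      then have "1 \<le> \<phi>0"
        using arccos_le_mono[of 0 k] k pi_gt3 unfolding \<phi>0_def by simp
      have "sqrt (1 - k\<^sup>2) \<le> 1" by simp
      then have "c \<le> 1 * \<phi>0"
        using c \<phi>0 mult_right_mono[of "sqrt (1 - k\<^sup>2)" 1 \<phi>0] unfolding \<phi>0_def by linarith
      then have "- k * c \<le> 1 * \<phi>0"
        using False k c by (intro mult_mono) auto
      also have "1 * \<phi>0 \<le> \<phi>0 * \<phi>0"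
        using \<open>1 \<le> \<phi>0\<close> by (intro mult_right_mono) auto
      finally show ?thesis by (simp add: power2_eq_square)
    qed
    then have "2 * X * (- k * c) \<le> 2 * X * \<phi>0\<^sup>2"
      using X by (intro mult_left_mono) auto
    have "1 + 2 * X \<le> E\<^sup>2"
      using exp_ge_add_one_self[of "2 * X"] unfolding E_def by (simp add: exp_double)
    then have "(1 - k\<^sup>2 + 2 * X) * \<phi>0\<^sup>2 \<le> (E\<^sup>2 - k\<^sup>2) * (X\<^sup>2 + \<phi>\<^sup>2)"
      using True \<phi>0 k2 X by (intro mult_mono add_increasing power_mono) auto
    also have "\<dots> = c\<^sup>2 + 2 * X * (- k * c)"
      using csq by (simp add: algebra_simps)
    finally have "(1 - k\<^sup>2) * \<phi>0\<^sup>2 \<le> c\<^sup>2"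
      using \<open>2 * X * (- k * c) \<le> 2 * X * \<phi>0\<^sup>2\<close> by (simp add: algebra_simps)
    also have "c\<^sup>2 < (sqrt (1 - k\<^sup>2) * \<phi>0)\<^sup>2"
      using c unfolding \<phi>0_def by (intro power_strict_mono) auto
    also have "\<dots> = (1 - k\<^sup>2) * \<phi>0\<^sup>2"
      using k2 by (simp add: power_mult_distrib)
    finally show False by simp
  next
    case False
    have "sin \<phi> > 0" using False \<phi> \<phi>0 by (intro sin_gt_zero) auto
    have "k < cos \<phi>"
      using False \<phi> \<phi>0 cos_monotone_0_pi[of \<phi> \<phi>0] by simp
    have EC: "E * cos \<phi> \<le> k" using C by (simp add: C_def)
    have "cos \<phi> < 0"
    proof (rule ccontr)
      assume "\<not> cos \<phi> < 0"
      then have "cos \<phi> \<le> E * cos \<phi>" using E mult_right_mono[of 1 E "cos \<phi>"] by simp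
      then show False using EC \<open>k < cos \<phi>\<close> by simp
    qed
    then have k0: "k < 0" using EC \<open>k < cos \<phi>\<close> by linarith
    have "pi / 2 \<le> \<phi>"
      using \<open>cos \<phi> < 0\<close> \<phi> cos_ge_zero[of \<phi>] by force
    have past: "sin \<phi> \<le> - \<phi> * cos \<phi>"
    proof (rule ccontr)
      assume "\<not> sin \<phi> \<le> - \<phi> * cos \<phi>"
      then have "X * E * (- \<phi> * cos \<phi>) \<le> X * E * sin \<phi>"
        using X E by (intro mult_left_mono) auto
      also have "\<dots> = \<phi> * (k - E * cos \<phi>)"
        using im unfolding E_def by (simp add: algebra_simps)
      finally have "\<phi> * (E * cos \<phi> * (1 - X)) \<le> \<phi> * k"
        by (simp add: algebra_simps)
      then have le: "E * cos \<phi> * (1 - X) \<le> k" using \<phi> by simp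
      have "1 - X \<le> exp (- X)" using exp_ge_add_one_self[of "- X"] by simp
      then have "E * (1 - X) \<le> 1"
        using E mult_left_mono[of "1 - X" "exp (- X)" E] unfolding E_def
        by (simp add: exp_minus)
      then have "cos \<phi> \<le> E * (1 - X) * cos \<phi>"
        using \<open>cos \<phi> < 0\<close> mult_right_mono_neg[of "E * (1 - X)" 1 "cos \<phi>"] by simp
      then show False using le \<open>k < cos \<phi>\<close> by (simp add: mult.commute mult.left_commute)
    qed
    have "sin \<phi> * \<phi>\<^sup>2 \<le> S * (X\<^sup>2 + \<phi>\<^sup>2)"
      unfolding S_def using E \<open>sin \<phi> > 0\<close> by (intro mult_mono) auto
    then have "\<phi> * (\<phi> * sin \<phi>) \<le> \<phi> * c"
      unfolding cphi[symmetric] by (simp add: algebra_simps power2_eq_square)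
    then have "\<phi> * sin \<phi> \<le> c" using \<phi> by simp
    moreover have "\<phi>0 * sin \<phi>0 \<le> \<phi> * sin \<phi>"
      using \<open>pi / 2 \<le> \<phi>\<close> False \<phi>0 past
      by (intro mult_sin_decreasing_past_maximum) auto
    ultimately show False using c \<phi>0 unfolding \<phi>0_def by (simp add: mult.commute)
  qed
qed


lemma no_root_closed_right_half_plane:
  fixes S :: complex and c k :: real
  assumes S: "0 \<le> Re S" and c: "0 < c" "c < sqrt (1 - k\<^sup>2) * arccos k" and k: "\<bar>k\<bar> < 1"
  shows "S * exp S \<noteq> k * S - c"
proof
  assume eq: "S * exp S = k * S - c"
  have re: "exp (Re S) * (Re S * cos (Im S) - Im S * sin (Im S)) = k * Re S - c"
    and im: "exp (Re S) * (Re S * sin (Im S) + Im S * cos (Im S)) = k * Im S"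
    using arg_cong[OF eq, of Re] arg_cong[OF eq, of Im]
    by (simp_all add: Re_exp Im_exp algebra_simps)
  consider "Im S > 0" | "Im S < 0" | "Im S = 0" by linarith
  then show False
  proof cases
    case 1
    then show False using no_root_upper_half_plane[OF S _ c k re im] by simp
  next
    case 2
    have "exp (Re S) * (Re S * cos (- Im S) - (- Im S) * sin (- Im S)) = k * Re S - c"
      and "exp (Re S) * (Re S * sin (- Im S) + (- Im S) * cos (- Im S)) = k * (- Im S)"
      using re im by (simp_all add: algebra_simps)
    from no_root_upper_half_plane[OF S _ c k this] show False using 2 by simp
  next
    case 3
    have "k * Re S \<le> 1 * Re S" using k S by (intro mult_right_mono) auto
    also have "1 * Re S \<le> exp (Re S) * Re S" using S by (intro mult_right_mono) auto
    also have "\<dots> = k * Re S - c" using re 3 by simp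
    finally show False using c by simp
  qed
qed

text \<open>Substituting \<open>s = \<zeta> k2 / (1 - \<zeta> k1)\<close> turns \<open>\<zeta> exp (s \<tau>) = 1\<close> into \<open>\<zeta> = exp (- s \<tau>)\<close> together with
\<open>s = exp (- s \<tau>) (k1 s + k2)\<close>. A zero in the closed unit disc is therefore a characteristic root in
the closed right half-plane.\<close>

lemma no_root_in_unit_disc:
  fixes \<zeta> :: complex and k1 k2 \<tau> :: real
  assumes \<zeta>: "norm \<zeta> \<le> 1" and k: "\<bar>k1\<bar> < 1" "k2 < 0" and \<tau>: "0 < \<tau>"
    and small: "\<bar>k2\<bar> * \<tau> < sqrt (1 - k1\<^sup>2) * arccos k1"
  shows "\<zeta> * exp (\<zeta> * k2 / (1 - \<zeta> * k1) * \<tau>) \<noteq> 1"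
proof
  define S where "S = \<zeta> * k2 / (1 - \<zeta> * k1) * \<tau>"
  assume "\<zeta> * exp (\<zeta> * k2 / (1 - \<zeta> * k1) * \<tau>) = 1"
  then have one: "\<zeta> * exp S = 1" by (simp add: S_def)
  have "norm (\<zeta> * k1) \<le> 1 * \<bar>k1\<bar>"
    using \<zeta> by (simp add: norm_mult mult_left_le_one_le)
  then have "\<zeta> * k1 \<noteq> 1" using k by auto
  then have "S * (1 - \<zeta> * k1) = \<zeta> * k2 * \<tau>"
    by (simp add: S_def)
  then have "S = \<zeta> * (k1 * S + k2 * \<tau>)"
    by (simp add: algebra_simps)
  then have "S * exp S = (\<zeta> * exp S) * (k1 * S + k2 * \<tau>)"
    by (metis mult.commute mult.assoc)
  then have "S * exp S = k1 * S - complex_of_real (\<bar>k2\<bar> * \<tau>)"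
    using one k by simp
  moreover have "0 \<le> Re S"
  proof -
    have "1 = norm \<zeta> * exp (Re S)"
      using arg_cong[OF one, of norm] by (simp add: norm_mult)
    also have "\<dots> \<le> 1 * exp (Re S)" using \<zeta> by (intro mult_right_mono) auto
    finally show ?thesis by simp
  qed
  moreover have "0 < \<bar>k2\<bar> * \<tau>"
    using k \<tau> by (intro mult_pos_pos) auto
  ultimately show False
    using no_root_closed_right_half_plane[OF _ _ small k(1)] by blast
qed

text \<open>Characteristic roots can reach the imaginary axis only at the frequency \<open>\<bar>k2\<bar> / sqrt (1 - k1\<^sup>2)\<close>, with
phase \<open>arccos k1\<close>; the three cases of the threshold express this phase by the arc tangent.\<close>

lemma tau0_eq_arccos:
  assumes "\<bar>k1\<bar> < 1"
  shows "tau0 k1 k2 = sqrt (1 - k1\<^sup>2) * arccos k1 / \<bar>k2\<bar>"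
proof -
  have pos: "arctan (sqrt (1 - x\<^sup>2) / x) = arccos x" if "0 < x" "x < 1" for x :: real
  proof -
    have "arccos x < pi / 2" "0 < arccos x"
      using arccos_less_mono[of x 0] arccos_lt_bounded[of x] that by simp_all
    then have "- (pi / 2) < arccos x"
      using pi_gt_zero by linarith
    moreover have "tan (arccos x) = sqrt (1 - x\<^sup>2) / x"
      using that by (simp add: tan_def sin_arccos)
    ultimately show ?thesis using \<open>arccos x < pi / 2\<close> arctan_unique by blast
  qed
  consider "k1 < 0" | "k1 = 0" | "k1 > 0" by linarith
  then show ?thesis
  proof cases
    case 1
    then have "pi - arctan (sqrt (1 - k1\<^sup>2) / \<bar>k1\<bar>) = arccos k1"
      using pos[of "- k1"] assms arccos_minus[of k1] by simp
    then show ?thesis using 1 by (simp add: tau0_def)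
  next
    case 2
    then show ?thesis by (simp add: tau0_def)
  next
    case 3
    then show ?thesis using pos[of k1] assms by (simp add: tau0_def)
  qed
qed

section \<open>Discrete renewal equations\<close>

text \<open>The power series \<open>1 - \<zeta> \<Sum> c\<^sub>n \<zeta>\<^sup>n\<close> is holomorphic on the disc of radius \<open>1/r > 1\<close>. Being free of zeros on
the compact unit disc, it is free of zeros on a slightly larger disc, and there its reciprocal is
given by its Taylor series.\<close>

lemma inverse_power_series_weighted_summable:
  fixes c :: "nat \<Rightarrow> real" and r :: real
  assumes r: "0 < r" "r < 1" and c: "\<And>n. \<bar>c n\<bar> \<le> M * r ^ n"
    and nz: "\<forall>\<zeta>::complex. norm \<zeta> \<le> 1 \<longrightarrow> 1 - \<zeta> * (\<Sum>n. of_real (c n) * \<zeta> ^ n) \<noteq> 0"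
  obtains R where "1 < R" "R < 1 / r"
    "summable (\<lambda>n. norm (fps_nth (inverse (1 - fps_X * Abs_fps (\<lambda>n. complex_of_real (c n)))) n) * R ^ n)"
proof -
  define F where "F = Abs_fps (\<lambda>n. complex_of_real (c n))"
  define G where "G = 1 - fps_X * F"
  have "summable (\<lambda>n. fps_nth F n * \<zeta> ^ n)" if "norm \<zeta> < 1 / r" for \<zeta>
  proof (rule summable_comparison_test')
    show "summable (\<lambda>n. M * (r * norm \<zeta>) ^ n)"
      using that r by (intro summable_mult summable_geometric) (simp add: field_simps)
    show "norm (fps_nth F n * \<zeta> ^ n) \<le> M * (r * norm \<zeta>) ^ n" for n
      using mult_right_mono[OF c[of n], of "norm \<zeta> ^ n"]
      by (simp add: F_def norm_mult norm_power power_mult_distrib mult.assoc)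
  qed
  then have radF: "ereal (1 / r) \<le> fps_conv_radius F"
    unfolding fps_conv_radius_def by (intro conv_radius_geI_ex') auto
  have "ereal (1 / r) \<le> fps_conv_radius G"
  proof -
    have "ereal (1 / r) \<le> fps_conv_radius (fps_X * F)"
      using radF by (intro order_trans[OF _ fps_conv_radius_mult]) simp
    then show ?thesis
      unfolding G_def by (intro order_trans[OF _ fps_conv_radius_diff]) simp
  qed
  then have in_disc: "ereal (norm \<zeta>) < fps_conv_radius G \<and> ereal (norm \<zeta>) < fps_conv_radius F"
    if "norm \<zeta> < 1 / r" for \<zeta> :: complex
    using that less_le_trans[OF _ radF, of "ereal (norm \<zeta>)"]
      less_le_trans[of "ereal (norm \<zeta>)" "ereal (1 / r)"] by simp
  have holG: "eval_fps G holomorphic_on ball 0 (1 / r)"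
    using in_disc by (intro holomorphic_on_eval_fps) (auto simp: in_eball_iff)
  have evalG: "eval_fps G \<zeta> = 1 - \<zeta> * (\<Sum>n. of_real (c n) * \<zeta> ^ n)" if "norm \<zeta> < 1 / r" for \<zeta>
  proof -
    have F: "ereal (norm \<zeta>) < fps_conv_radius F" using in_disc[OF that] by simp
    then have "ereal (norm \<zeta>) < fps_conv_radius (fps_X * F)"
      by (intro less_le_trans[OF _ fps_conv_radius_mult]) simp
    then have "eval_fps G \<zeta> = eval_fps 1 \<zeta> - eval_fps (fps_X * F) \<zeta>"
      unfolding G_def by (intro eval_fps_diff) auto
    also have "eval_fps (fps_X * F) \<zeta> = eval_fps fps_X \<zeta> * eval_fps F \<zeta>"
      using F by (intro eval_fps_mult) auto
    finally have "eval_fps G \<zeta> = 1 - \<zeta> * eval_fps F \<zeta>" by simp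
    then show ?thesis by (simp add: eval_fps_def F_def)
  qed
  have "1 < 1 / r" using r by simp
  define U where "U = {\<zeta> \<in> ball 0 (1 / r). eval_fps G \<zeta> \<noteq> 0}"
  have "open U"
    using continuous_open_preimage[OF holomorphic_on_imp_continuous_on[OF holG] open_ball open_Compl[OF closed_singleton[of 0]]]
    unfolding U_def by (simp add: vimage_def Int_def)
  moreover have "cball 0 1 \<subseteq> U"
    using nz evalG \<open>1 < 1 / r\<close> by (auto simp: U_def)
  ultimately obtain \<epsilon> where \<epsilon>: "\<epsilon> > 0" "(\<Union>x\<in>cball 0 1. cball x \<epsilon>) \<subseteq> U"
    using compact_subset_open_imp_cball_epsilon_subset[OF compact_cball] by metis
  define R' where "R' = 1 + min \<epsilon> (1 / r - 1)"
  have R': "1 < R'" "R' \<le> 1 / r" "R' \<le> 1 + \<epsilon>"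
    using \<epsilon> \<open>1 < 1 / r\<close> unfolding R'_def by auto
  have "\<zeta> \<in> U" if "norm \<zeta> < R'" for \<zeta>
  proof (cases "norm \<zeta> \<le> 1")
    case True
    then show ?thesis using \<open>cball 0 1 \<subseteq> U\<close> by auto
  next
    case False
    then have "norm \<zeta> \<noteq> 0" by linarith
    then have "dist (sgn \<zeta>) \<zeta> = norm ((1 - norm \<zeta>) *\<^sub>R sgn \<zeta>)"
      using False by (simp add: dist_norm sgn_div_norm scaleR_diff_left algebra_simps)
    also have "\<dots> \<le> \<epsilon>" using False that R' by (simp add: norm_sgn)
    finally have "\<zeta> \<in> cball (sgn \<zeta>) \<epsilon>" by simp
    moreover have "sgn \<zeta> \<in> cball 0 1" by (simp add: norm_sgn)
    ultimately show ?thesis using \<epsilon> by blast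
  qed
  then have nzR: "eval_fps G \<zeta> \<noteq> 0" if "\<zeta> \<in> eball 0 (ereal R')" for \<zeta>
    using that by (auto simp: U_def in_eball_iff)
  have "ereal R' \<le> fps_conv_radius G"
    using R' \<open>ereal (1 / r) \<le> fps_conv_radius G\<close> by (meson ereal_less_eq(3) order_trans)
  have "min (ereal R') (fps_conv_radius G) \<le> fps_conv_radius (inverse G)"
    using nzR by (intro fps_conv_radius_inverse) (simp add: in_eball_iff)
  then have "ereal R' \<le> fps_conv_radius (inverse G)"
    using \<open>ereal R' \<le> fps_conv_radius G\<close> by (simp add: min_def)
  define R where "R = (1 + R') / 2"
  have R: "1 < R" "R < R'" using R' by (auto simp: R_def)
  have "summable (\<lambda>n. norm (fps_nth (inverse G) n * complex_of_real R ^ n))"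
  proof (intro abs_summable_in_conv_radius)
    have "ereal (norm (complex_of_real R)) < ereal R'" using R by simp
    also note \<open>ereal R' \<le> fps_conv_radius (inverse G)\<close>
    finally show "ereal (norm (complex_of_real R)) < conv_radius (fps_nth (inverse G))"
      by (simp add: fps_conv_radius_def)
  qed
  then have "summable (\<lambda>n. norm (fps_nth (inverse G) n) * R ^ n)"
    using R by (simp add: norm_mult norm_power)
  then show ?thesis
    using that[of R] R R' unfolding G_def F_def by simp
qed

text \<open>The recursion for \<open>p\<close> says that the generating functions satisfy \<open>(1 - \<zeta> c(\<zeta>)) p(\<zeta>) = d(\<zeta>)\<close>, so \<open>p\<close> is the
convolution of \<open>d\<close> with the coefficients of \<open>1 / (1 - \<zeta> c(\<zeta>))\<close>, which are summable with weight
\<open>(1/s)\<^sup>n\<close>. The bound \<open>x s\<^sup>n + y\<close> separates a decaying part, later due to the initial state, from a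
persistent one, later due to the input.\<close>

lemma renewal_exponential_bound:
  fixes c :: "nat \<Rightarrow> real" and r :: real
  assumes r: "0 < r" "r < 1" and c: "\<And>n. \<bar>c n\<bar> \<le> M * r ^ n"
    and nz: "\<forall>\<zeta>::complex. norm \<zeta> \<le> 1 \<longrightarrow> 1 - \<zeta> * (\<Sum>n. of_real (c n) * \<zeta> ^ n) \<noteq> 0"
  shows "\<exists>s S. r < s \<and> s < 1 \<and> 0 \<le> S \<and> (\<forall>p d x y.
    p 0 = d 0 \<and> (\<forall>n. p (Suc n) = (\<Sum>m\<le>n. c (n - m) * p m) + d (Suc n)) \<and>
    0 \<le> x \<and> 0 \<le> y \<and> (\<forall>n. \<bar>d n\<bar> \<le> x * s ^ n + y) \<longrightarrow> (\<forall>n. \<bar>p n\<bar> \<le> S * (x * s ^ n + y)))"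
proof -
  define F where "F = Abs_fps (\<lambda>n. complex_of_real (c n))"
  define b where "b = fps_nth (inverse (1 - fps_X * F))"
  obtain R where R: "1 < R" "R < 1 / r" and sum: "summable (\<lambda>n. norm (b n) * R ^ n)"
    using inverse_power_series_weighted_summable[OF r c nz] unfolding b_def F_def by blast
  define S where "S = (\<Sum>n. norm (b n) * R ^ n)"
  have "0 \<le> S" unfolding S_def using R by (intro suminf_nonneg[OF sum]) auto
  have Sb: "(\<Sum>m\<le>n. norm (b m) * R ^ m) \<le> S" for n
    unfolding S_def using R by (intro sum_le_suminf[OF sum]) auto
  have "\<bar>p n\<bar> \<le> S * (x * (1 / R) ^ n + y)"
    if p0: "p 0 = d 0" and p: "\<And>n. p (Suc n) = (\<Sum>m\<le>n. c (n - m) * p m) + d (Suc n)"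
      and xy: "0 \<le> x" "0 \<le> y" and d: "\<And>n. \<bar>d n\<bar> \<le> x * (1 / R) ^ n + y"
    for p d :: "nat \<Rightarrow> real" and x y :: real and n
  proof -
    define P D where "P = Abs_fps (\<lambda>n. complex_of_real (p n))"
      and "D = Abs_fps (\<lambda>n. complex_of_real (d n))"
    have "P = fps_X * (F * P) + D"
    proof (rule fps_ext)
      fix n show "fps_nth P n = fps_nth (fps_X * (F * P) + D) n"
      proof (cases n)
        case 0 then show ?thesis by (simp add: P_def D_def p0)
      next
        case (Suc m)
        have "fps_nth (F * P) m = fps_nth (P * F) m" by (simp add: mult.commute)
        also have "\<dots> = of_real (\<Sum>i\<le>m. c (m - i) * p i)"
          unfolding F_def P_def
          by (simp add: fps_mult_nth atLeast0AtMost) (simp add: mult.commute)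
        finally have "fps_nth (F * P) m = of_real (\<Sum>i\<le>m. c (m - i) * p i)" .
        then show ?thesis unfolding Suc by (simp add: D_def P_def p)
      qed
    qed
    then have "P - fps_X * (F * P) = D" by (metis add_diff_cancel_left')
    then have "(1 - fps_X * F) * P = D" by (simp add: left_diff_distrib mult.assoc)
    moreover have "inverse (1 - fps_X * F) * (1 - fps_X * F) = 1"
      by (rule inverse_mult_eq_1) simp
    ultimately have "P = inverse (1 - fps_X * F) * D"
      by (metis mult.assoc mult_1)
    then have "fps_nth P n = fps_nth (inverse (1 - fps_X * F) * D) n" by (rule arg_cong)
    then have "complex_of_real (p n) = (\<Sum>m\<le>n. b m * of_real (d (n - m)))"
      by (simp add: fps_mult_nth b_def P_def D_def atLeast0AtMost)
    then have "\<bar>p n\<bar> = norm (\<Sum>m\<le>n. b m * of_real (d (n - m)))"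
      by (metis norm_of_real)
    also have "\<dots> \<le> (\<Sum>m\<le>n. norm (b m * of_real (d (n - m))))"
      by (rule norm_sum)
    also have "\<dots> \<le> (\<Sum>m\<le>n. norm (b m) * R ^ m * (x * (1 / R) ^ n + y))"
    proof (rule sum_mono)
      fix m assume "m \<in> {..n}"
      then have "m \<le> n" by simp
      have "x * (1 / R) ^ (n - m) + y \<le> R ^ m * (x * (1 / R) ^ n) + R ^ m * y"
      proof (rule add_mono)
        show "x * (1 / R) ^ (n - m) \<le> R ^ m * (x * (1 / R) ^ n)"
          using \<open>m \<le> n\<close> R by (simp add: power_diff field_simps)
        show "y \<le> R ^ m * y"
          using R xy mult_right_mono[of 1 "R ^ m" y] by simp
      qed
      then have "\<bar>d (n - m)\<bar> \<le> R ^ m * (x * (1 / R) ^ n + y)"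
        using d[of "n - m"] by (simp add: algebra_simps)
      then show "norm (b m * of_real (d (n - m))) \<le> norm (b m) * R ^ m * (x * (1 / R) ^ n + y)"
        by (simp add: norm_mult mult_left_mono mult.assoc)
    qed
    also have "\<dots> = (\<Sum>m\<le>n. norm (b m) * R ^ m) * (x * (1 / R) ^ n + y)"
      by (simp add: sum_distrib_right)
    also have "\<dots> \<le> S * (x * (1 / R) ^ n + y)"
      using Sb R xy by (intro mult_right_mono) auto
    finally show ?thesis .
  qed
  moreover have "r < 1 / R" "1 / R < 1"
    using R r by (simp_all add: field_simps)
  ultimately show ?thesis using \<open>0 \<le> S\<close> by (intro exI[of _ "1 / R"] exI[of _ S]) blast
qed

section \<open>Responses to a unit starting value\<close>

text \<open>In the norm \<open>sup \<bar>f x\<bar> exp (- \<eta> x)\<close> integration has norm at most \<open>1/\<eta>\<close>. With \<open>\<eta>\<close> large this makes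
\<open>f \<mapsto> k1 f + k2 \<integral> f\<close> a contraction whenever \<open>\<bar>k1\<bar> < 1\<close>, whatever the size of \<open>k2\<close> and of the delay.\<close>

lemma integral_bound_exp_weight:
  fixes f :: "real \<Rightarrow> real"
  assumes int: "f integrable_on {0..\<theta>}" and "0 < \<eta>" "0 \<le> \<theta>" "0 \<le> M"
    and bound: "\<And>x. 0 \<le> x \<Longrightarrow> x \<le> \<theta> \<Longrightarrow> \<bar>f x\<bar> \<le> M * exp (\<eta> * x)"
  shows "\<bar>integral {0..\<theta>} f\<bar> \<le> M / \<eta> * exp (\<eta> * \<theta>)"
proof -
  have "((\<lambda>x. M * exp (\<eta> * x)) has_integral (M / \<eta> * exp (\<eta> * \<theta>) - M / \<eta> * exp (\<eta> * 0))) {0..\<theta>}"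
    using assms by (intro fundamental_theorem_of_calculus)
      (auto intro!: derivative_eq_intros simp flip: has_real_derivative_iff_has_vector_derivative)
  then have "norm (integral {0..\<theta>} f) \<le> M / \<eta> * exp (\<eta> * \<theta>) - M / \<eta> * exp (\<eta> * 0)"
    using integral_norm_bound_integral[OF int, of "\<lambda>x. M * exp (\<eta> * x)"] bound
    by (auto simp: has_integral_iff)
  also have "\<dots> \<le> M / \<eta> * exp (\<eta> * \<theta>)" using assms by simp
  finally show ?thesis by simp
qed

text \<open>Cut time into blocks of length \<open>\<tau>\<close>. The function with index \<open>n\<close> is what a block starting at the value
\<open>1\<close> contributes to the \<open>n\<close>-th block after it, if all later blocks start at the value \<open>0\<close>. The term
\<open>of_bool (n = 0)\<close> subtracts the starting value: over one delay the neutral equation transmits the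
increment \<open>k1 (z - z 0)\<close> within a block, not \<open>k1 z\<close> itself.\<close>

primrec pulse_response :: "real \<Rightarrow> real \<Rightarrow> nat \<Rightarrow> real \<Rightarrow> real" where
  "pulse_response k1 k2 0 = (\<lambda>\<theta>. 1)"
| "pulse_response k1 k2 (Suc n) = (\<lambda>\<theta>. k1 * (pulse_response k1 k2 n \<theta> - of_bool (n = 0))
     + k2 * integral {0..\<theta>} (pulse_response k1 k2 n))"

lemma continuous_on_pulse_response: "continuous_on {0..\<tau>} (pulse_response k1 k2 n)"
proof (induction n)
  case (Suc n)
  then show ?case
    unfolding pulse_response.simps
    by (intro continuous_intros indefinite_integral_continuous_1 integrable_continuous_interval)
qed simp

lemma pulse_response_bound:
  assumes "0 < \<eta>" "0 \<le> \<theta>"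
  shows "\<bar>pulse_response k1 k2 n \<theta>\<bar> \<le> (\<bar>k1\<bar> + \<bar>k2\<bar> / \<eta>) ^ n * exp (\<eta> * \<theta>)"
  using \<open>0 \<le> \<theta>\<close>
proof (induction n arbitrary: \<theta>)
  case 0
  then show ?case using assms by simp
next
  case (Suc n)
  define r where "r = \<bar>k1\<bar> + \<bar>k2\<bar> / \<eta>"
  have "0 \<le> r" using assms by (simp add: r_def)
  have "\<bar>pulse_response k1 k2 n \<theta> - of_bool (n = 0)\<bar> \<le> r ^ n * exp (\<eta> * \<theta>)"
    using Suc unfolding r_def by (cases n) auto
  moreover have "\<bar>integral {0..\<theta>} (pulse_response k1 k2 n)\<bar> \<le> r ^ n / \<eta> * exp (\<eta> * \<theta>)"
    using Suc assms \<open>0 \<le> r\<close> unfolding r_def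
    by (intro integral_bound_exp_weight integrable_continuous_interval continuous_on_pulse_response) auto
  ultimately have "\<bar>pulse_response k1 k2 (Suc n) \<theta>\<bar>
      \<le> \<bar>k1\<bar> * (r ^ n * exp (\<eta> * \<theta>)) + \<bar>k2\<bar> * (r ^ n / \<eta> * exp (\<eta> * \<theta>))"
    unfolding pulse_response.simps
    by (intro order_trans[OF abs_triangle_ineq] add_mono) (simp_all only: abs_mult mult_left_mono abs_ge_zero)
  also have "\<dots> = r ^ Suc n * exp (\<eta> * \<theta>)"
    by (simp add: r_def algebra_simps)
  finally show ?case by (simp add: r_def)
qed

text \<open>The product of the solution with \<open>exp (- a \<theta>)\<close> has derivative zero.\<close>

lemma exp_unique_integral_equation:
  fixes E :: "real \<Rightarrow> complex" and a :: complex
  assumes cont: "continuous_on {0..\<tau>} E" and "0 \<le> \<tau>"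
    and eq: "\<And>\<theta>. 0 \<le> \<theta> \<Longrightarrow> \<theta> \<le> \<tau> \<Longrightarrow> E \<theta> = 1 + a * integral {0..\<theta>} E"
  shows "E \<tau> = exp (a * \<tau>)"
proof -
  define h where "h \<theta> = E \<theta> * exp (- a * of_real \<theta>)" for \<theta>
  have "(h has_vector_derivative 0) (at \<theta> within {0..\<tau>})" if "\<theta> \<in> {0..\<tau>}" for \<theta>
  proof -
    have "((\<lambda>\<theta>. integral {0..\<theta>} E) has_vector_derivative E \<theta>) (at \<theta> within {0..\<tau>})"
      by (rule integral_has_vector_derivative[OF cont that])
    then have "((\<lambda>\<theta>. 1 + a * integral {0..\<theta>} E) has_vector_derivative a * E \<theta>) (at \<theta> within {0..\<tau>})"
      by (auto intro!: derivative_eq_intros)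
    then have "(E has_vector_derivative a * E \<theta>) (at \<theta> within {0..\<tau>})"
      by (rule has_vector_derivative_transform[rotated 2]) (use that eq in auto)
    moreover have "((\<lambda>\<theta>. exp (- a * of_real \<theta>)) has_vector_derivative - a * exp (- a * of_real \<theta>))
        (at \<theta> within {0..\<tau>})"
      by (rule has_vector_derivative_real_field) (auto intro!: derivative_eq_intros)
    ultimately show ?thesis unfolding h_def
      by (auto intro!: derivative_eq_intros)
  qed
  then have "h \<tau> = h 0"
    using has_vector_derivative_zero_constant[of "{0..\<tau>}" h] \<open>0 \<le> \<tau>\<close>
    by (metis atLeastAtMost_iff convex_real_interval(5) order_refl)
  moreover have "h 0 = 1" using eq[of 0] \<open>0 \<le> \<tau>\<close> by (simp add: h_def)
  ultimately show ?thesis by (simp add: h_def exp_minus field_simps)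
qed

text \<open>As a function of \<open>\<theta>\<close>, the series \<open>E\<close> inherits from the recursion of the responses the equation
\<open>(1 - \<zeta> k1) (E - 1) = \<zeta> k2 \<integral> E\<close>, whose solution is an exponential. This is where the characteristic
equation of the delay system comes in.\<close>

lemma pulse_response_generating_function:
  fixes \<zeta> :: complex
  assumes \<zeta>: "norm \<zeta> \<le> 1" and \<eta>: "0 < \<eta>" "\<bar>k1\<bar> + \<bar>k2\<bar> / \<eta> < 1" and "0 \<le> \<tau>"
  shows "(\<Sum>n. of_real (pulse_response k1 k2 n \<tau>) * \<zeta> ^ n) = exp (\<zeta> * k2 / (1 - \<zeta> * k1) * \<tau>)"
proof -
  define r where "r = \<bar>k1\<bar> + \<bar>k2\<bar> / \<eta>"
  have r: "0 \<le> r" "r < 1" using \<eta> by (auto simp: r_def)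
  define f where "f n \<theta> = of_real (pulse_response k1 k2 n \<theta>) * \<zeta> ^ n" for n \<theta>
  define E where "E \<theta> = (\<Sum>n. f n \<theta>)" for \<theta>
  have contf: "continuous_on {0..\<theta>} (f n)" for n \<theta>
    unfolding f_def by (intro continuous_intros continuous_on_pulse_response)
  have normf: "norm (f n \<theta>) \<le> exp (\<eta> * \<tau>) * r ^ n" if "\<theta> \<in> {0..\<tau>}" for n \<theta>
  proof -
    have "norm (f n \<theta>) \<le> \<bar>pulse_response k1 k2 n \<theta>\<bar> * 1"
      unfolding f_def using \<zeta> by (simp add: norm_mult norm_power power_le_one mult_right_le_one_le)
    also have "\<dots> \<le> r ^ n * exp (\<eta> * \<theta>)"
      using pulse_response_bound[OF \<eta>(1), of \<theta> k1 k2 n] that by (simp add: r_def)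
    also have "\<dots> \<le> r ^ n * exp (\<eta> * \<tau>)"
      using r that \<eta> by (intro mult_left_mono) auto
    finally show ?thesis by (simp add: mult.commute)
  qed
  have "uniform_limit {0..\<tau>} (\<lambda>N \<theta>. \<Sum>n<N. f n \<theta>) E sequentially"
    unfolding E_def using normf r
    by (intro Weierstrass_m_test[where M = "\<lambda>n. exp (\<eta> * \<tau>) * r ^ n"]) auto
  then have lim: "uniform_limit {0..\<theta>} (\<lambda>N \<theta>. \<Sum>n<N. f n \<theta>) E sequentially" if "\<theta> \<le> \<tau>" for \<theta>
    by (rule uniform_limit_on_subset) (use that in auto)
  have contE: "continuous_on {0..\<tau>} E"
    using lim[of \<tau>] contf by (intro uniform_limit_theorem[OF _ lim[of \<tau>]])
      (auto intro!: continuous_intros always_eventually)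
  have "\<zeta> * k1 \<noteq> 1"
  proof -
    have "norm (\<zeta> * k1) \<le> \<bar>k1\<bar>" using \<zeta> by (simp add: norm_mult mult_left_le_one_le)
    moreover have "\<bar>k1\<bar> < 1" using \<eta> by (smt (verit) divide_nonneg_pos abs_ge_zero)
    ultimately show ?thesis by auto
  qed
  have "E \<theta> = 1 + \<zeta> * k2 / (1 - \<zeta> * k1) * integral {0..\<theta>} E" if \<theta>: "0 \<le> \<theta>" "\<theta> \<le> \<tau>" for \<theta>
  proof -
    have fint: "f n integrable_on {0..\<theta>}" for n
      by (intro integrable_continuous_interval contf)
    have f_Suc: "f (Suc n) \<theta> = \<zeta> * k1 * (f n \<theta> - of_bool (n = 0)) + \<zeta> * k2 * integral {0..\<theta>} (f n)" for n
    proof -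
      have "integral {0..\<theta>} (f n) = integral {0..\<theta>} (\<lambda>\<theta>. complex_of_real (pulse_response k1 k2 n \<theta>)) * \<zeta> ^ n"
        unfolding f_def by simp
      also have "integral {0..\<theta>} (\<lambda>\<theta>. complex_of_real (pulse_response k1 k2 n \<theta>))
          = of_real (integral {0..\<theta>} (pulse_response k1 k2 n))"
        using integral_linear[OF integrable_continuous_interval[OF continuous_on_pulse_response] bounded_linear_of_real, of \<theta> k1 k2 n]
        by (simp add: o_def)
      finally have J: "integral {0..\<theta>} (f n) = of_real (integral {0..\<theta>} (pulse_response k1 k2 n)) * \<zeta> ^ n" .
      have "\<zeta> * k1 * (f n \<theta> - of_bool (n = 0))
          = of_real (k1 * (pulse_response k1 k2 n \<theta> - of_bool (n = 0))) * \<zeta> ^ Suc n"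
        by (cases "n = 0") (simp_all add: f_def algebra_simps)
      then show ?thesis unfolding J by (simp add: f_def algebra_simps)
    qed
    have partial: "(\<Sum>n<Suc (Suc N). f n \<theta>) = 1 + \<zeta> * k1 * ((\<Sum>n<Suc N. f n \<theta>) - 1)
        + \<zeta> * k2 * integral {0..\<theta>} (\<lambda>\<theta>. \<Sum>n<Suc N. f n \<theta>)" for N
    proof -
      have "(\<Sum>n<Suc (Suc N). f n \<theta>) = f 0 \<theta> + (\<Sum>n<Suc N. f (Suc n) \<theta>)"
        by (rule sum.lessThan_Suc_shift)
      also have "(\<Sum>n<Suc N. f (Suc n) \<theta>) = \<zeta> * k1 * ((\<Sum>n<Suc N. f n \<theta>) - (\<Sum>n<Suc N. of_bool (n = 0)))
          + \<zeta> * k2 * (\<Sum>n<Suc N. integral {0..\<theta>} (f n))"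
        unfolding f_Suc by (simp only: sum.distrib sum_subtractf sum_distrib_left[symmetric])
      also have "(\<Sum>n<Suc N. of_bool (n = 0)) = (1::complex)"
        by (simp add: sum.lessThan_Suc_shift)
      also have "(\<Sum>n<Suc N. integral {0..\<theta>} (f n)) = integral {0..\<theta>} (\<lambda>\<theta>. \<Sum>n<Suc N. f n \<theta>)"
        using fint by (intro integral_sum[symmetric]) auto
      finally show ?thesis by (simp add: f_def)
    qed
    obtain I J where I: "\<And>N. ((\<lambda>\<theta>. \<Sum>n<N. f n \<theta>) has_integral I N) {0..\<theta>}"
        and J: "(E has_integral J) {0..\<theta>}" "I \<longlonglongrightarrow> J"
    proof (rule uniform_limit_integral[OF lim[OF \<theta>(2)]])
      show "continuous_on {0..\<theta>} (\<lambda>\<theta>. \<Sum>n<N. f n \<theta>)" for N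
        by (intro continuous_intros contf)
    qed auto
    have "(\<lambda>N. \<Sum>n<N. f n \<theta>) \<longlonglongrightarrow> E \<theta>"
      using tendsto_uniform_limitI[OF lim[OF \<theta>(2)]] \<theta> by simp
    then have l1: "(\<lambda>N. \<Sum>n<Suc N. f n \<theta>) \<longlonglongrightarrow> E \<theta>" and l2: "(\<lambda>N. \<Sum>n<Suc (Suc N). f n \<theta>) \<longlonglongrightarrow> E \<theta>"
      using LIMSEQ_Suc[of "\<lambda>N. \<Sum>n<N. f n \<theta>"] LIMSEQ_Suc[of "\<lambda>N. \<Sum>n<Suc N. f n \<theta>"] by blast+
    have "(\<lambda>N. 1 + \<zeta> * k1 * ((\<Sum>n<Suc N. f n \<theta>) - 1) + \<zeta> * k2 * I (Suc N))
        \<longlonglongrightarrow> 1 + \<zeta> * k1 * (E \<theta> - 1) + \<zeta> * k2 * J"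
      by (intro tendsto_intros l1 LIMSEQ_Suc[OF J(2)])
    then have "E \<theta> = 1 + \<zeta> * k1 * (E \<theta> - 1) + \<zeta> * k2 * J"
      using l2 LIMSEQ_unique unfolding partial integral_unique[OF I] by blast
    then have "(E \<theta> - 1) * (1 - \<zeta> * k1) = \<zeta> * k2 * J"
      by (simp add: algebra_simps)
    then have "E \<theta> = 1 + \<zeta> * k2 / (1 - \<zeta> * k1) * J"
      using \<open>\<zeta> * k1 \<noteq> 1\<close> by (simp add: field_simps)
    then show ?thesis using J by (simp add: has_integral_iff)
  qed
  from exp_unique_integral_equation[OF contE \<open>0 \<le> \<tau>\<close> this] show ?thesis
    by (simp add: E_def f_def)
qed

section \<open>Iterated contractions on a delay interval\<close>

text \<open>The sequences \<open>x s\<^sup>n / (s - r)\<close> and \<open>y / (1 - r)\<close> solve the recursion with forcing terms \<open>x s\<^sup>n\<close> and \<open>y\<close>,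
and \<open>v 0 * s\<^sup>n\<close> dominates the homogeneous solution.\<close>

lemma delayed_recursion_bound:
  fixes v :: "nat \<Rightarrow> real"
  assumes "0 \<le> r" "r < s" "s < 1" "0 \<le> x" "0 \<le> y" "0 \<le> v 0"
    and step: "\<And>n. v (Suc n) = r * v n + (x * s ^ n + y)"
  shows "v n \<le> (v 0 + x / (s - r)) * s ^ n + y / (1 - r)"
proof (induction n)
  case 0
  then show ?case using assms by simp
next
  case (Suc n)
  have "v (Suc n) \<le> r * ((v 0 + x / (s - r)) * s ^ n + y / (1 - r)) + (x * s ^ n + y)"
    unfolding step using Suc assms by (intro add_mono mult_left_mono) auto
  also have "\<dots> = (r * v 0 + (r * (x / (s - r)) + x)) * s ^ n + (r * (y / (1 - r)) + y)"
    by (simp add: algebra_simps)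
  also have "r * (x / (s - r)) + x = s * (x / (s - r))"
    using assms by (simp add: field_simps)
  also have "r * (y / (1 - r)) + y = y / (1 - r)"
    using assms by (simp add: field_simps)
  also have "(r * v 0 + s * (x / (s - r))) * s ^ n \<le> (s * v 0 + s * (x / (s - r))) * s ^ n"
    using assms by (intro mult_right_mono add_mono) auto
  finally show ?case by (simp add: algebra_simps)
qed

text \<open>The contraction in the exponentially weighted norm, iterated: \<open>r\<close> bounds the norm of
\<open>a \<mapsto> k1 a + k2 \<integral> a\<close>, and the factor \<open>exp (\<eta> \<tau>)\<close> is the price for returning to the unweighted norm.\<close>

lemma delay_iteration_bound:
  fixes a g :: "nat \<Rightarrow> real \<Rightarrow> real"
  assumes "0 < \<eta>" and r: "r = \<bar>k1\<bar> + \<bar>k2\<bar> / \<eta>" "r < s" "s < 1"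
    and "0 \<le> x" "0 \<le> y" "0 \<le> B" and "0 \<le> \<theta>" "\<theta> \<le> \<tau>"
    and int: "\<And>n. a n integrable_on {0..\<tau>}"
    and step: "\<And>n \<theta>. 0 \<le> \<theta> \<Longrightarrow> \<theta> \<le> \<tau> \<Longrightarrow> a (Suc n) \<theta> = k1 * a n \<theta> + k2 * integral {0..\<theta>} (a n) + g n \<theta>"
    and g: "\<And>n \<theta>. 0 \<le> \<theta> \<Longrightarrow> \<theta> \<le> \<tau> \<Longrightarrow> \<bar>g n \<theta>\<bar> \<le> x * s ^ n + y"
    and a0: "\<And>\<theta>. 0 \<le> \<theta> \<Longrightarrow> \<theta> \<le> \<tau> \<Longrightarrow> \<bar>a 0 \<theta>\<bar> \<le> B"
  shows "\<bar>a n \<theta>\<bar> \<le> ((B + x / (s - r)) * s ^ n + y / (1 - r)) * exp (\<eta> * \<tau>)"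
proof -
  have "0 \<le> r" using r \<open>0 < \<eta>\<close> by simp
  define v where "v = rec_nat B (\<lambda>n w. r * w + (x * s ^ n + y))"
  have v0: "v 0 = B" and vS: "v (Suc n) = r * v n + (x * s ^ n + y)" for n
    by (simp_all add: v_def)
  have vpos: "0 \<le> v n" for n
    by (induction n) (use v0 vS \<open>0 \<le> B\<close> \<open>0 \<le> x\<close> \<open>0 \<le> y\<close> \<open>0 \<le> r\<close> \<open>r < s\<close> in auto)
  have bound: "\<bar>a n \<theta>\<bar> \<le> v n * exp (\<eta> * \<theta>)" if "0 \<le> \<theta>" "\<theta> \<le> \<tau>" for n \<theta>
    using that
  proof (induction n arbitrary: \<theta>)
    case 0
    have "B * 1 \<le> B * exp (\<eta> * \<theta>)"
      using \<open>0 \<le> B\<close> \<open>0 < \<eta>\<close> 0 by (intro mult_left_mono) auto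
    then show ?case using a0[OF 0] v0 by simp
  next
    case (Suc n)
    have I: "\<bar>integral {0..\<theta>} (a n)\<bar> \<le> v n / \<eta> * exp (\<eta> * \<theta>)"
      using Suc vpos \<open>0 < \<eta>\<close>
      by (intro integral_bound_exp_weight integrable_on_subinterval[OF int]) auto
    have xs: "0 \<le> x * s ^ n + y"
      using \<open>0 \<le> x\<close> \<open>0 \<le> y\<close> \<open>0 \<le> r\<close> \<open>r < s\<close> by auto
    have "\<bar>g n \<theta>\<bar> \<le> (x * s ^ n + y) * 1" using g Suc.prems by simp
    also have "\<dots> \<le> (x * s ^ n + y) * exp (\<eta> * \<theta>)"
      using xs \<open>0 < \<eta>\<close> Suc.prems by (intro mult_left_mono) auto
    finally have G: "\<bar>g n \<theta>\<bar> \<le> (x * s ^ n + y) * exp (\<eta> * \<theta>)" .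
    have "\<bar>a (Suc n) \<theta>\<bar> \<le> \<bar>k1\<bar> * \<bar>a n \<theta>\<bar> + \<bar>k2\<bar> * \<bar>integral {0..\<theta>} (a n)\<bar> + \<bar>g n \<theta>\<bar>"
      unfolding step[OF Suc.prems] by (simp only: abs_mult[symmetric])
    also have "\<dots> \<le> \<bar>k1\<bar> * (v n * exp (\<eta> * \<theta>)) + \<bar>k2\<bar> * (v n / \<eta> * exp (\<eta> * \<theta>))
        + (x * s ^ n + y) * exp (\<eta> * \<theta>)"
      using Suc.IH[OF Suc.prems] I G by (intro add_mono mult_left_mono) auto
    also have "\<dots> = v (Suc n) * exp (\<eta> * \<theta>)"
      unfolding vS r by (simp add: algebra_simps)
    finally show ?case .
  qed
  have "\<bar>a n \<theta>\<bar> \<le> v n * exp (\<eta> * \<theta>)" using bound assms by blast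
  also have "\<dots> \<le> v n * exp (\<eta> * \<tau>)"
    using vpos assms by (intro mult_left_mono) auto
  also have "\<dots> \<le> ((B + x / (s - r)) * s ^ n + y / (1 - r)) * exp (\<eta> * \<tau>)"
    using delayed_recursion_bound[of r s x y v n] v0 vS vpos[of 0] assms \<open>0 \<le> r\<close>
    by (intro mult_right_mono) auto
  finally show ?thesis .
qed

section \<open>The integrated neutral equation\<close>

text \<open>The neutral equation integrated from \<open>\<tau>\<close> to \<open>t\<close>, with a primitive \<open>H\<close> of the input in place of the input.
It makes sense for a discontinuous history, and restricting it to \<open>t \<le> T\<close> expresses causality.\<close>

definition neutral_equation_upto ::
  "real \<Rightarrow> real \<Rightarrow> real \<Rightarrow> (real \<Rightarrow> real) \<Rightarrow> real \<Rightarrow> (real \<Rightarrow> real) \<Rightarrow> bool" where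
  "neutral_equation_upto k1 k2 \<tau> H T z \<longleftrightarrow> (\<forall>t. \<tau> \<le> t \<and> t \<le> T \<longrightarrow>
     z t = k1 * z (t - \<tau>) + (z \<tau> - k1 * z 0) + k2 * integral {0..t - \<tau>} z + (H t - H \<tau>))"

text \<open>The right-hand side at \<open>t\<close> involves the solution only up to \<open>t - \<tau>\<close>, so uniqueness propagates from
\<open>[0, n \<tau>]\<close> to \<open>[0, (n + 1) \<tau>]\<close>.\<close>

lemma neutral_equation_unique:
  assumes \<tau>: "0 < \<tau>" and z: "neutral_equation_upto k1 k2 \<tau> H T z" and w: "neutral_equation_upto k1 k2 \<tau> H T w"
    and history: "\<And>t. 0 \<le> t \<Longrightarrow> t \<le> \<tau> \<Longrightarrow> w t = z t" and t: "0 \<le> t" "t \<le> T"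
  shows "w t = z t"
proof -
  have "w t = z t" if "0 \<le> t" "t \<le> T" "t \<le> real n * \<tau>" for n t
    using that
  proof (induction n arbitrary: t)
    case 0
    then show ?case using history \<tau> by simp
  next
    case (Suc n)
    show ?case
    proof (cases "t \<le> \<tau>")
      case True
      then show ?thesis using history Suc by simp
    next
      case False
      have agree: "w x = z x" if "x \<in> {0..t - \<tau>}" for x
        using that Suc.prems \<tau> by (intro Suc.IH) (auto simp: algebra_simps)
      then have "integral {0..t - \<tau>} w = integral {0..t - \<tau>} z"
        by (rule integral_cong)
      moreover have "w (t - \<tau>) = z (t - \<tau>)" "w \<tau> = z \<tau>" "w 0 = z 0"
        using agree[of "t - \<tau>"] False history[of 0] history[of \<tau>] \<tau> by auto
      moreover have "f t = k1 * f (t - \<tau>) + (f \<tau> - k1 * f 0) + k2 * integral {0..t - \<tau>} f + (H t - H \<tau>)"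
        if "neutral_equation_upto k1 k2 \<tau> H T f" for f
        using that[unfolded neutral_equation_upto_def, THEN spec, of t] False Suc.prems by linarith
      ultimately show ?thesis using z w by metis
    qed
  qed
  moreover obtain n where "t \<le> real n * \<tau>"
    using reals_Archimedean3[OF \<tau>] less_imp_le by blast
  ultimately show ?thesis using t by blast
qed

lemma integrable_on_if_le:
  fixes f g :: "real \<Rightarrow> real"
  assumes f: "f integrable_on {0..\<tau>}" and g: "\<tau> \<le> a \<Longrightarrow> g integrable_on {\<tau>..a}" and "0 \<le> \<tau>"
  shows "(\<lambda>t. if t \<le> \<tau> then f t else g t) integrable_on {0..a}"
proof (cases "\<tau> \<le> a")
  case True
  have "(\<lambda>t. if t \<le> \<tau> then f t else g t) integrable_on {0..\<tau>}"
    by (rule integrable_eq[OF f]) auto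
  moreover have "(\<lambda>t. if t \<le> \<tau> then f t else g t) integrable_on {\<tau>..a}"
    by (rule integrable_spike[OF g[OF True], of "{\<tau>}"]) auto
  ultimately show ?thesis
    using True \<open>0 \<le> \<tau>\<close> by (intro Henstock_Kurzweil_Integration.integrable_combine[of 0 \<tau> a]) auto
next
  case False
  have "f integrable_on {0..a}" by (rule integrable_on_subinterval[OF f]) (use False in auto)
  then show ?thesis by (rule integrable_eq) (use False in auto)
qed

lemma bounded_image_if_le:
  fixes f g :: "real \<Rightarrow> real"
  assumes "bounded (f ` {0..\<tau>})" and "bounded (g ` {\<tau>..a})"
  shows "bounded ((\<lambda>t. if t \<le> \<tau> then f t else g t) ` {0..a})"
  by (rule bounded_subset[of "f ` {0..\<tau>} \<union> g ` {\<tau>..a}"]) (use assms in \<open>auto simp: not_le\<close>)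

text \<open>One sweep of the method of steps: it turns a function that is correct on \<open>[0, n \<tau>]\<close> into one that is
correct on \<open>[0, (n + 1) \<tau>]\<close>.\<close>

definition method_of_steps ::
  "real \<Rightarrow> real \<Rightarrow> real \<Rightarrow> (real \<Rightarrow> real) \<Rightarrow> (real \<Rightarrow> real) \<Rightarrow> (real \<Rightarrow> real) \<Rightarrow> real \<Rightarrow> real" where
  "method_of_steps k1 k2 \<tau> H h w = (\<lambda>t. if t \<le> \<tau> then h t else
     k1 * w (t - \<tau>) + (h \<tau> - k1 * h 0) + k2 * integral {0..t - \<tau>} w + (H t - H \<tau>))"

lemma method_of_steps_integrable_bounded:
  assumes \<tau>: "0 < \<tau>" and h: "h integrable_on {0..\<tau>}" "bounded (h ` {0..\<tau>})" and H: "continuous_on {\<tau>..} H"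
    and w: "\<And>a. w integrable_on {0..a}" "\<And>a. bounded (w ` {0..a})"
  shows "method_of_steps k1 k2 \<tau> H h w integrable_on {0..a}"
    and "bounded (method_of_steps k1 k2 \<tau> H h w ` {0..a})"
proof -
  define c where "c t = (h \<tau> - k1 * h 0) + k2 * integral {0..t - \<tau>} w + (H t - H \<tau>)" for t
  have "continuous_on {0..a - \<tau>} (\<lambda>x. integral {0..x} w)"
    by (rule indefinite_integral_continuous_1[OF w(1)])
  then have "continuous_on {\<tau>..a} (\<lambda>t. integral {0..t - \<tau>} w)"
    by (rule continuous_on_compose2) (auto intro!: continuous_intros)
  then have cont: "continuous_on {\<tau>..a} c"
    unfolding c_def by (intro continuous_intros continuous_on_subset[OF H]) auto
  have shift: "(\<lambda>t. w (t - \<tau>)) integrable_on {\<tau>..a}"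
    using integrable_shift_real_ivl[OF w(1)[of "a - \<tau>"], of "- \<tau>"] by simp
  have step: "method_of_steps k1 k2 \<tau> H h w = (\<lambda>t. if t \<le> \<tau> then h t else k1 * w (t - \<tau>) + c t)"
    unfolding method_of_steps_def c_def by (intro ext) simp
  show "method_of_steps k1 k2 \<tau> H h w integrable_on {0..a}"
    unfolding step using \<tau>
    by (intro integrable_on_if_le h(1) integrable_add integrable_on_mult_right shift
        integrable_continuous_interval cont) auto
  have "bounded ((\<lambda>t. w (t - \<tau>)) ` {\<tau>..a})"
    by (rule bounded_subset[OF w(2)[of "a - \<tau>"]]) auto
  moreover have "bounded (c ` {\<tau>..a})"
    using compact_continuous_image[OF cont] compact_imp_bounded by blast
  ultimately have "bounded ((\<lambda>t. k1 * w (t - \<tau>) + c t) ` {\<tau>..a})"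
    using bounded_plus_comp[of "\<lambda>t. k1 * w (t - \<tau>)" "{\<tau>..a}" c]
      bounded_scaling[of "(\<lambda>t. w (t - \<tau>)) ` {\<tau>..a}" k1] by (simp add: image_image)
  then show "bounded (method_of_steps k1 k2 \<tau> H h w ` {0..a})"
    unfolding step using h by (intro bounded_image_if_le)
qed

text \<open>The iterates of the method of steps stabilise on every bounded interval, the \<open>n\<close>-th one being final
on \<open>[0, n \<tau>]\<close>. Each is bounded and integrable, so every integral in the equation exists.\<close>

lemma neutral_equation_exists:
  assumes \<tau>: "0 < \<tau>" and h: "h integrable_on {0..\<tau>}" "bounded (h ` {0..\<tau>})" and H: "continuous_on {\<tau>..} H"
  shows "\<exists>z. (\<forall>t\<le>\<tau>. z t = h t) \<and> (\<forall>a. z integrable_on {0..a}) \<and> (\<forall>a. bounded (z ` {0..a}))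
    \<and> (\<forall>T. neutral_equation_upto k1 k2 \<tau> H T z)"
proof -
  define Z where "Z n = (method_of_steps k1 k2 \<tau> H h ^^ n) (\<lambda>t. if t \<le> \<tau> then h t else 0)" for n
  have Z_Suc: "Z (Suc n) = method_of_steps k1 k2 \<tau> H h (Z n)" for n by (simp add: Z_def)
  have Z: "(\<forall>a. Z n integrable_on {0..a}) \<and> (\<forall>a. bounded (Z n ` {0..a}))" for n
  proof (induction n)
    case 0
    have "bounded ((\<lambda>_. 0 :: real) ` {\<tau>..a})" for a by (simp add: image_constant_conv)
    then show ?case using \<tau> unfolding Z_def funpow_0
      by (intro conjI allI integrable_on_if_le bounded_image_if_le h) auto
  next
    case (Suc n)
    then show ?case
      unfolding Z_Suc by (intro allI conjI method_of_steps_integrable_bounded[OF \<tau> h H]) auto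
  qed
  have Zh: "Z n t = h t" if "t \<le> \<tau>" for n t
    using that by (cases n) (simp_all add: Z_def method_of_steps_def)
  have coherent: "Z (Suc n) t = Z n t" if "t \<le> real (Suc n) * \<tau>" for n t
    using that
  proof (induction n arbitrary: t)
    case 0
    then show ?case by (simp add: Zh)
  next
    case (Suc n)
    show ?case
    proof (cases "t \<le> \<tau>")
      case True
      then show ?thesis by (simp add: Zh)
    next
      case False
      have agree: "Z (Suc n) x = Z n x" if "x \<le> t - \<tau>" for x
        using that Suc.prems by (intro Suc.IH) (simp add: algebra_simps)
      then have "integral {0..t - \<tau>} (Z (Suc n)) = integral {0..t - \<tau>} (Z n)"
        by (intro integral_cong) auto
      then show ?thesis
        using agree[of "t - \<tau>"] by (subst (1 2) Z_Suc) (simp add: method_of_steps_def)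
    qed
  qed
  define z where "z t = Z (nat \<lceil>t / \<tau>\<rceil>) t" for t
  have zZ: "z t = Z n t" if "t \<le> real n * \<tau>" for n t
  proof -
    define N where "N = nat \<lceil>t / \<tau>\<rceil>"
    have "t / \<tau> \<le> real N" unfolding N_def by linarith
    then have N: "t \<le> real N * \<tau>" using \<tau> by (simp add: divide_le_eq)
    have "t / \<tau> \<le> real n" using that \<tau> by (simp add: divide_le_eq)
    then have "N \<le> n" by (simp add: N_def nat_le_iff ceiling_le_iff)
    have "Z (N + k) t = Z N t" for k
    proof (induction k)
      case (Suc k)
      have "real N * \<tau> \<le> real (Suc (N + k)) * \<tau>" using \<tau> by (intro mult_right_mono) auto
      then show ?case using Suc coherent[of t "N + k"] N by simp
    qed simp
    from this[of "n - N"] \<open>N \<le> n\<close> show ?thesis by (simp add: z_def N_def)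
  qed
  have large: "\<exists>n. a \<le> real n * \<tau>" for a
    using reals_Archimedean3[OF \<tau>] less_imp_le by blast
  have zh: "z t = h t" if "t \<le> \<tau>" for t using that by (simp add: z_def Zh)
  have "z integrable_on {0..a}" "bounded (z ` {0..a})" for a
  proof -
    obtain n where "a \<le> real n * \<tau>" using large by blast
    then have *: "Z n t = z t" if "t \<in> {0..a}" for t using that by (intro zZ[symmetric]) auto
    show "z integrable_on {0..a}" by (rule integrable_eq[OF _ *]) (use Z in auto)
    have "z ` {0..a} = Z n ` {0..a}" using * by (intro image_cong) auto
    then show "bounded (z ` {0..a})" using Z by simp
  qed
  moreover have "neutral_equation_upto k1 k2 \<tau> H T z" for T
    unfolding neutral_equation_upto_def
  proof (intro allI impI, elim conjE)
    fix t assume t: "\<tau> \<le> t" "t \<le> T"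
    have h0: "z \<tau> = h \<tau>" "z 0 = h 0" using zh \<tau> by auto
    show "z t = k1 * z (t - \<tau>) + (z \<tau> - k1 * z 0) + k2 * integral {0..t - \<tau>} z + (H t - H \<tau>)"
    proof (cases "t = \<tau>")
      case False
      obtain n where n: "t \<le> real n * \<tau>" using large by blast
      then have zn: "z x = Z n x" if "x \<le> t" for x using that by (intro zZ) auto
      have "z t = Z (Suc n) t" using n \<tau> by (intro zZ) (simp add: algebra_simps)
      moreover have "integral {0..t - \<tau>} z = integral {0..t - \<tau>} (Z n)"
        using zn \<tau> by (intro integral_cong) auto
      moreover have "z (t - \<tau>) = Z n (t - \<tau>)" using zn \<tau> by simp
      ultimately show ?thesis
        using False t unfolding h0 by (simp add: Z_Suc method_of_steps_def)
    qed simp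
  qed
  ultimately show ?thesis using zh by blast
qed

section \<open>Exponential estimate\<close>

text \<open>Put \<open>y n \<theta> = z (n \<tau> + \<theta>)\<close> and \<open>p n = z (n \<tau>)\<close>. Subtracting the contributions of the starting values \<open>p m\<close>,
\<open>m \<le> n\<close>, that are carried by the pulse responses leaves \<open>a n\<close>, which evolves under the contraction
\<open>a \<mapsto> k1 a + k2 \<integral> a\<close> and is driven by the input alone. The identity \<open>p (n + 1) = y n \<tau>\<close> is then a
renewal equation for \<open>p\<close> with kernel \<open>c n\<close>, the pulse response at \<open>\<tau>\<close>, and with data \<open>a n \<tau>\<close>. The
generating function of \<open>c\<close> is an exponential, and \<open>1\<close> minus \<open>\<zeta>\<close> times this exponential has no zero in
the closed unit disc, hence \<open>p\<close> obeys the same kind of bound as its data. A second use of the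
contraction, now with \<open>p\<close> as a known forcing term, controls the solution inside the blocks.\<close>

lemma neutral_exponential_bound:
  fixes k1 k2 \<tau> :: real
  assumes k: "\<bar>k1\<bar> < 1" "k2 < 0" and \<tau>: "0 < \<tau>"
    and small: "\<bar>k2\<bar> * \<tau> < sqrt (1 - k1\<^sup>2) * arccos k1"
  shows "\<exists>C>0. \<exists>\<sigma>>0. \<forall>z H B \<kappa>. (\<forall>a. z integrable_on {0..a}) \<and> (\<forall>T. neutral_equation_upto k1 k2 \<tau> H T z) \<and>
       (\<forall>s\<in>{0..\<tau>}. \<bar>z s\<bar> \<le> B) \<and> (\<forall>s t. \<tau> \<le> s \<and> s \<le> t \<longrightarrow> \<bar>H t - H s\<bar> \<le> \<kappa> * (t - s)) \<longrightarrow>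
       (\<forall>t\<ge>0. \<bar>z t\<bar> \<le> C * (B * exp (- \<sigma> * t) + \<kappa>))"
proof -
  \<comment> \<open>This weight gives the contraction constant \<open>r = (1 + \<bar>k1\<bar>) / 2\<close>.\<close>
  define \<eta> where "\<eta> = 2 * \<bar>k2\<bar> / (1 - \<bar>k1\<bar>)"
  define r where "r = \<bar>k1\<bar> + \<bar>k2\<bar> / \<eta>"
  have "0 < \<eta>" unfolding \<eta>_def using k by (intro divide_pos_pos) auto
  have r_eq: "r = (1 + \<bar>k1\<bar>) / 2" using k unfolding r_def \<eta>_def by (simp add: field_split_simps)
  have r: "0 < r" "r < 1" using k unfolding r_eq by auto
  define c where "c n = pulse_response k1 k2 n \<tau>" for n
  have c: "\<bar>c n\<bar> \<le> exp (\<eta> * \<tau>) * r ^ n" for n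
    using pulse_response_bound[OF \<open>0 < \<eta>\<close>, of \<tau> k1 k2 n] \<tau> by (simp add: c_def r_def mult.commute)
  have nz: "\<forall>\<zeta>::complex. norm \<zeta> \<le> 1 \<longrightarrow> 1 - \<zeta> * (\<Sum>n. of_real (c n) * \<zeta> ^ n) \<noteq> 0"
  proof (intro allI impI)
    fix \<zeta> :: complex assume \<zeta>: "norm \<zeta> \<le> 1"
    have "(\<Sum>n. of_real (c n) * \<zeta> ^ n) = exp (\<zeta> * k2 / (1 - \<zeta> * k1) * \<tau>)"
      unfolding c_def using r \<tau>
      by (intro pulse_response_generating_function[OF \<zeta> \<open>0 < \<eta>\<close>]) (auto simp: r_def)
    then show "1 - \<zeta> * (\<Sum>n. of_real (c n) * \<zeta> ^ n) \<noteq> 0"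
      using no_root_in_unit_disc[OF \<zeta> k \<tau> small] by (simp only: right_minus_eq)
  qed
  obtain s S where s: "r < s" "s < 1" and "0 \<le> S" and renewal: "\<forall>p d x y.
      p 0 = d 0 \<and> (\<forall>n. p (Suc n) = (\<Sum>m\<le>n. c (n - m) * p m) + d (Suc n)) \<and>
      0 \<le> x \<and> 0 \<le> y \<and> (\<forall>n. \<bar>d n\<bar> \<le> x * s ^ n + y) \<longrightarrow> (\<forall>n. \<bar>p n\<bar> \<le> S * (x * s ^ n + y))"
    using renewal_exponential_bound[OF r c nz] by (elim exE conjE)
  have "0 < s" using r s by simp
  define e where "e = exp (\<eta> * \<tau>)"
  have "1 \<le> e" using \<open>0 < \<eta>\<close> \<tau> by (simp add: e_def)
  \<comment> \<open>The pair \<open>X0, Y0\<close> bounds the data of the renewal equation, the pair \<open>X1, Y1\<close> the forcing within a block.\<close>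
  define X0 Y0 X1 Y1 where "X0 = 2 * e / s" and "Y0 = \<tau> / (1 - r) * e"
    and "X1 = \<bar>k2\<bar> * \<tau> * (S * X0)" and "Y1 = \<bar>k2\<bar> * \<tau> * (S * Y0) + \<tau>"
  have XY: "0 \<le> X0" "0 \<le> Y0" "0 \<le> X1" "0 \<le> Y1"
    using \<open>1 \<le> e\<close> \<open>0 < s\<close> \<tau> r \<open>0 \<le> S\<close> unfolding X0_def Y0_def X1_def Y1_def by auto
  define CB C\<kappa> where "CB = (2 + X1 / (s - r)) * e + S * X0" and "C\<kappa> = Y1 / (1 - r) * e + S * Y0"
  have CC: "2 \<le> CB" "0 \<le> C\<kappa>"
  proof -
    have "2 * 1 \<le> (2 + X1 / (s - r)) * e"
      using XY s \<open>1 \<le> e\<close> by (intro mult_mono) auto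
    then show "2 \<le> CB" using XY \<open>0 \<le> S\<close> by (simp add: CB_def add_increasing2)
    show "0 \<le> C\<kappa>" using XY r \<open>1 \<le> e\<close> \<open>0 \<le> S\<close> by (simp add: C\<kappa>_def)
  qed
  define \<sigma> where "\<sigma> = - ln s / \<tau>"
  have "0 < \<sigma>" using s \<open>0 < s\<close> \<tau> by (simp add: \<sigma>_def divide_neg_pos)
  have main: "\<bar>z t\<bar> \<le> (CB / s + C\<kappa>) * (B * exp (- \<sigma> * t) + \<kappa>)"
    if int: "\<And>a. z integrable_on {0..a}" and eq: "\<And>T. neutral_equation_upto k1 k2 \<tau> H T z"
      and B: "\<And>s. 0 \<le> s \<Longrightarrow> s \<le> \<tau> \<Longrightarrow> \<bar>z s\<bar> \<le> B"
      and H: "\<And>s t. \<tau> \<le> s \<Longrightarrow> s \<le> t \<Longrightarrow> \<bar>H t - H s\<bar> \<le> \<kappa> * (t - s)" and "0 \<le> t"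
    for z H :: "real \<Rightarrow> real" and B \<kappa> t :: real
  proof -
    have "0 \<le> B" using B[of 0] \<tau> by auto
    have "0 \<le> \<kappa>" using H[of \<tau> "\<tau> + 1"] by auto
    define y where "y n \<theta> = z (\<theta> + real n * \<tau>)" for n \<theta>
    define p where "p n = z (real n * \<tau>)" for n
    define G where "G n \<theta> = H (\<theta> + real (Suc n) * \<tau>) - H (real (Suc n) * \<tau>)" for n \<theta>
    have G: "\<bar>G n \<theta>\<bar> \<le> \<kappa> * \<tau>" if "0 \<le> \<theta>" "\<theta> \<le> \<tau>" for n \<theta>
    proof -
      have "\<bar>G n \<theta>\<bar> \<le> \<kappa> * \<theta>"
        using H[of "real (Suc n) * \<tau>" "\<theta> + real (Suc n) * \<tau>"] that \<tau> unfolding G_def by simp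
      also have "\<dots> \<le> \<kappa> * \<tau>" using that \<open>0 \<le> \<kappa>\<close> by (intro mult_left_mono) auto
      finally show ?thesis .
    qed
    have yint: "y n integrable_on {0..\<tau>}" for n
    proof -
      have "z integrable_on {real n * \<tau>..\<tau> + real n * \<tau>}"
        by (rule integrable_on_subinterval[OF int[of "\<tau> + real n * \<tau>"]]) (use \<tau> in auto)
      from integrable_shift_real_ivl[OF this, of "real n * \<tau>"] show ?thesis
        by (simp add: y_def[abs_def])
    qed
    have ystep: "y (Suc n) \<theta> = k1 * (y n \<theta> - p n) + p (Suc n) + k2 * integral {0..\<theta>} (y n) + G n \<theta>"
      if \<theta>: "0 \<le> \<theta>" "\<theta> \<le> \<tau>" for n \<theta>
    proof -
      have e: "z t = k1 * z (t - \<tau>) + (z \<tau> - k1 * z 0) + k2 * integral {0..t - \<tau>} z + (H t - H \<tau>)"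
        if "\<tau> \<le> t" for t
        using eq[of t, unfolded neutral_equation_upto_def, THEN spec, of t] that by blast
      have shift: "\<theta> + real (Suc n) * \<tau> - \<tau> = \<theta> + real n * \<tau>" "real (Suc n) * \<tau> - \<tau> = real n * \<tau>"
        by (simp_all add: algebra_simps)
      have late: "\<tau> \<le> \<theta> + real (Suc n) * \<tau>" "\<tau> \<le> real (Suc n) * \<tau>"
        using \<theta> \<tau> by (simp_all add: algebra_simps)
      have "integral {0..real n * \<tau>} z + integral {real n * \<tau>..\<theta> + real n * \<tau>} z
          = integral {0..\<theta> + real n * \<tau>} z"
        using \<theta> \<tau> by (intro Henstock_Kurzweil_Integration.integral_combine int) auto
      moreover have "integral {real n * \<tau>..\<theta> + real n * \<tau>} z = integral {0..\<theta>} (y n)"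
        using integral_shift_real_ivl[of "real n * \<tau>" "real n * \<tau>" "\<theta> + real n * \<tau>" z]
        by (simp add: y_def[abs_def])
      ultimately have "k2 * integral {0..\<theta> + real n * \<tau>} z
          = k2 * integral {0..real n * \<tau>} z + k2 * integral {0..\<theta>} (y n)"
        by (metis distrib_left)
      moreover have "y (Suc n) \<theta> = k1 * y n \<theta> + (z \<tau> - k1 * z 0)
          + k2 * integral {0..\<theta> + real n * \<tau>} z + (H (\<theta> + real (Suc n) * \<tau>) - H \<tau>)"
        using e[OF late(1)] unfolding shift y_def .
      moreover have "p (Suc n) = k1 * p n + (z \<tau> - k1 * z 0)
          + k2 * integral {0..real n * \<tau>} z + (H (real (Suc n) * \<tau>) - H \<tau>)"
        using e[OF late(2)] unfolding shift p_def .
      ultimately show ?thesis unfolding G_def right_diff_distrib by linarith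
    qed
    have y0: "\<bar>y 0 \<theta>\<bar> \<le> B" if "0 \<le> \<theta>" "\<theta> \<le> \<tau>" for \<theta>
      using B that by (simp add: y_def)
    have p0: "\<bar>p 0\<bar> \<le> B" using B \<tau> by (simp add: p_def)
    define a where "a n \<theta> = y n \<theta> - (\<Sum>m\<le>n. p m * pulse_response k1 k2 (n - m) \<theta>)" for n \<theta>
    have print: "(\<lambda>\<theta>. p m * pulse_response k1 k2 (n - m) \<theta>) integrable_on {0..\<theta>}" for n m \<theta>
      by (intro integrable_continuous_interval continuous_intros continuous_on_pulse_response)
    have aint: "a n integrable_on {0..\<tau>}" for n
      unfolding a_def by (intro integrable_diff yint integrable_sum print) auto
    have astep: "a (Suc n) \<theta> = k1 * a n \<theta> + k2 * integral {0..\<theta>} (a n) + G n \<theta>"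
      if \<theta>: "0 \<le> \<theta>" "\<theta> \<le> \<tau>" for n \<theta>
    proof -
      have I: "integral {0..\<theta>} (a n) = integral {0..\<theta>} (y n)
          - (\<Sum>m\<le>n. p m * integral {0..\<theta>} (pulse_response k1 k2 (n - m)))"
        unfolding a_def using integrable_on_subinterval[OF yint, of 0 \<theta>] \<theta> print
        by (subst integral_diff) (auto intro!: integrable_sum simp: integral_sum)
      have "(\<Sum>m\<le>n. p m * of_bool (n - m = 0)) = (\<Sum>m\<le>n. if m = n then p m else 0)"
        by (intro sum.cong) auto
      then have of_bool: "(\<Sum>m\<le>n. p m * of_bool (n - m = 0)) = p n" by simp
      have "(\<Sum>m\<le>Suc n. p m * pulse_response k1 k2 (Suc n - m) \<theta>)
          = (\<Sum>m\<le>n. p m * pulse_response k1 k2 (Suc (n - m)) \<theta>) + p (Suc n)"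
        by (simp add: Suc_diff_le)
      also have "(\<Sum>m\<le>n. p m * pulse_response k1 k2 (Suc (n - m)) \<theta>)
          = k1 * ((\<Sum>m\<le>n. p m * pulse_response k1 k2 (n - m) \<theta>) - (\<Sum>m\<le>n. p m * of_bool (n - m = 0)))
            + k2 * (\<Sum>m\<le>n. p m * integral {0..\<theta>} (pulse_response k1 k2 (n - m)))"
        unfolding pulse_response.simps sum_distrib_left sum_subtractf[symmetric] sum.distrib[symmetric]
        by (intro sum.cong refl) (simp only: distrib_left right_diff_distrib mult.left_commute)
      finally show ?thesis
        using ystep[OF \<theta>, of n] unfolding a_def[of "Suc n"] a_def[of n] I of_bool right_diff_distrib
        by linarith
    qed
    have abound: "\<bar>a n \<theta>\<bar> \<le> (2 * B * s ^ n + \<kappa> * \<tau> / (1 - r)) * e" if \<theta>: "0 \<le> \<theta>" "\<theta> \<le> \<tau>" for n \<theta>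
    proof -
      have "\<bar>a 0 \<theta>\<bar> \<le> 2 * B" if "0 \<le> \<theta>" "\<theta> \<le> \<tau>" for \<theta>
        using y0[OF that] p0 by (simp add: a_def)
      from delay_iteration_bound[OF \<open>0 < \<eta>\<close> r_def s, of 0 "\<kappa> * \<tau>", OF _ _ _ \<theta> aint astep _ this]
      show ?thesis using G \<open>0 \<le> B\<close> \<open>0 \<le> \<kappa>\<close> \<tau> by (simp add: e_def)
    qed
    define d where "d n = (case n of 0 \<Rightarrow> p 0 | Suc m \<Rightarrow> a m \<tau>)" for n
    have d: "\<bar>d n\<bar> \<le> B * X0 * s ^ n + \<kappa> * Y0" for n
    proof (cases n)
      case 0
      have "B * 1 \<le> B * X0"
      proof (rule mult_left_mono)
        have "s \<le> 2 * e" using s \<open>1 \<le> e\<close> by linarith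
        then show "1 \<le> X0" using \<open>0 < s\<close> by (simp add: X0_def)
      qed fact
      then show ?thesis using 0 p0 \<open>0 \<le> \<kappa>\<close> XY by (simp add: d_def add_increasing2)
    next
      case (Suc m)
      have "B * X0 * s ^ n + \<kappa> * Y0 = (2 * B * s ^ m + \<kappa> * \<tau> / (1 - r)) * e"
        using \<open>0 < s\<close> by (simp add: Suc X0_def Y0_def field_simps)
      then show ?thesis using abound[of \<tau> m] \<tau> Suc by (simp add: d_def)
    qed
    have pstep: "p (Suc n) = (\<Sum>m\<le>n. c (n - m) * p m) + d (Suc n)" for n
    proof -
      have "p (Suc n) = y n \<tau>" by (simp add: p_def y_def algebra_simps)
      then show ?thesis by (simp add: d_def a_def c_def mult.commute)
    qed
    have p: "\<bar>p n\<bar> \<le> S * (B * X0 * s ^ n + \<kappa> * Y0)" for n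
      by (rule renewal[THEN spec[of _ p], THEN spec[of _ d], THEN spec, THEN spec, THEN mp, THEN spec],
          intro conjI allI pstep d) (use XY \<open>0 \<le> B\<close> \<open>0 \<le> \<kappa>\<close> in \<open>auto simp: d_def\<close>)
    have u: "\<bar>y n \<theta> - p n\<bar> \<le> ((2 * B + B * X1 / (s - r)) * s ^ n + \<kappa> * Y1 / (1 - r)) * e"
      if \<theta>: "0 \<le> \<theta>" "\<theta> \<le> \<tau>" for n \<theta>
    proof -
      have "\<bar>y n \<theta> - p n\<bar> \<le> ((2 * B + B * X1 / (s - r)) * s ^ n + \<kappa> * Y1 / (1 - r)) * exp (\<eta> * \<tau>)"
      proof (rule delay_iteration_bound[OF \<open>0 < \<eta>\<close> r_def s, where a = "\<lambda>n \<theta>. y n \<theta> - p n" and \<tau> = \<tau>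
            and g = "\<lambda>n \<theta>. k2 * \<theta> * p n + G n \<theta>"])
        fix n \<theta> assume \<theta>: "0 \<le> \<theta>" "\<theta> \<le> \<tau>"
        have I: "integral {0..\<theta>} (\<lambda>x. y n x - p n) = integral {0..\<theta>} (y n) - \<theta> * p n"
          using integrable_on_subinterval[OF yint, of 0 \<theta>] \<theta> by (subst integral_diff) auto
        show "y (Suc n) \<theta> - p (Suc n) = k1 * (y n \<theta> - p n)
            + k2 * integral {0..\<theta>} (\<lambda>x. y n x - p n) + (k2 * \<theta> * p n + G n \<theta>)"
          unfolding I using ystep[OF \<theta>, of n] by (simp add: algebra_simps)
        have "\<bar>k2 * \<theta> * p n\<bar> \<le> \<bar>k2\<bar> * \<tau> * (S * (B * X0 * s ^ n + \<kappa> * Y0))"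
          unfolding abs_mult using \<theta> p by (intro mult_mono) auto
        then have "\<bar>k2 * \<theta> * p n + G n \<theta>\<bar> \<le> \<bar>k2\<bar> * \<tau> * (S * (B * X0 * s ^ n + \<kappa> * Y0)) + \<kappa> * \<tau>"
          using G[OF \<theta>, of n] by linarith
        also have "\<dots> = B * X1 * s ^ n + \<kappa> * Y1"
          by (simp add: X1_def Y1_def algebra_simps)
        finally show "\<bar>k2 * \<theta> * p n + G n \<theta>\<bar> \<le> B * X1 * s ^ n + \<kappa> * Y1" .
        show "\<bar>y 0 \<theta> - p 0\<bar> \<le> 2 * B" using y0[OF \<theta>] p0 by linarith
      qed (use XY \<open>0 \<le> B\<close> \<open>0 \<le> \<kappa>\<close> \<theta> yint in \<open>auto intro!: integrable_diff\<close>)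
      then show ?thesis by (simp add: e_def)
    qed
    define n where "n = nat \<lfloor>t / \<tau>\<rfloor>"
    define \<theta> where "\<theta> = t - real n * \<tau>"
    have "real n = of_int \<lfloor>t / \<tau>\<rfloor>" using \<open>0 \<le> t\<close> \<tau> by (simp add: n_def)
    then have "real n \<le> t / \<tau>" "t / \<tau> \<le> real n + 1" by linarith+
    then have \<theta>: "0 \<le> \<theta>" "\<theta> \<le> \<tau>"
      using \<tau> unfolding \<theta>_def by (simp_all add: field_simps)
    have "\<bar>z t\<bar> = \<bar>y n \<theta>\<bar>" by (simp add: y_def \<theta>_def)
    also have "\<dots> \<le> \<bar>y n \<theta> - p n\<bar> + \<bar>p n\<bar>" by linarith
    also have "\<dots> \<le> ((2 * B + B * X1 / (s - r)) * s ^ n + \<kappa> * Y1 / (1 - r)) * e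
        + S * (B * X0 * s ^ n + \<kappa> * Y0)"
      using u[OF \<theta>] p by (intro add_mono)
    also have "\<dots> = CB * (B * s ^ n) + C\<kappa> * \<kappa>"
      unfolding CB_def C\<kappa>_def by (simp add: algebra_simps)
    also have "\<dots> \<le> CB * (B * (exp (- \<sigma> * t) / s)) + C\<kappa> * \<kappa>"
    proof -
      have "exp (- \<sigma> * \<tau>) = s" using \<tau> \<open>0 < s\<close> by (simp add: \<sigma>_def)
      have "s ^ n * s = exp (- \<sigma> * (real n * \<tau>)) * exp (- \<sigma> * \<tau>)"
        unfolding \<open>exp (- \<sigma> * \<tau>) = s\<close>[symmetric] by (simp add: algebra_simps flip: exp_of_nat_mult)
      also have "\<dots> \<le> exp (- \<sigma> * (real n * \<tau>)) * exp (- \<sigma> * \<theta>)"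
        using \<theta> \<open>0 < \<sigma>\<close> by (intro mult_left_mono) auto
      also have "\<dots> = exp (- \<sigma> * t)"
        by (simp add: \<theta>_def algebra_simps flip: exp_add)
      finally have "s ^ n \<le> exp (- \<sigma> * t) / s" using \<open>0 < s\<close> by (simp add: field_simps)
      then show ?thesis
        using CC \<open>0 \<le> B\<close> by (intro add_right_mono mult_left_mono) auto
    qed
    also have "\<dots> = CB / s * (B * exp (- \<sigma> * t)) + C\<kappa> * \<kappa>" by simp
    also have "\<dots> \<le> (CB / s + C\<kappa>) * (B * exp (- \<sigma> * t)) + (CB / s + C\<kappa>) * \<kappa>"
      using CC \<open>0 < s\<close> \<open>0 \<le> B\<close> \<open>0 \<le> \<kappa>\<close> by (intro add_mono mult_right_mono) auto
    finally show ?thesis by (simp add: algebra_simps)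
  qed
  have "0 < CB / s + C\<kappa>" using CC \<open>0 < s\<close> by (simp add: add_pos_nonneg)
  show ?thesis
  proof (rule exI[of _ "CB / s + C\<kappa>"], intro conjI)
    show "\<exists>\<sigma>>0. \<forall>z H B \<kappa>. (\<forall>a. z integrable_on {0..a}) \<and> (\<forall>T. neutral_equation_upto k1 k2 \<tau> H T z) \<and>
       (\<forall>s\<in>{0..\<tau>}. \<bar>z s\<bar> \<le> B) \<and> (\<forall>s t. \<tau> \<le> s \<and> s \<le> t \<longrightarrow> \<bar>H t - H s\<bar> \<le> \<kappa> * (t - s)) \<longrightarrow>
       (\<forall>t\<ge>0. \<bar>z t\<bar> \<le> (CB / s + C\<kappa>) * (B * exp (- \<sigma> * t) + \<kappa>))"
      by (rule exI[of _ \<sigma>], intro conjI allI impI \<open>0 < \<sigma>\<close>, elim conjE, rule main) auto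
  qed fact
qed

section \<open>Absolutely continuous functions\<close>

lemma AE_lebesgue_on_iff:
  "S \<in> sets lebesgue \<Longrightarrow> (AE t in lebesgue_on S. P t) \<longleftrightarrow> (AE t in lebesgue. t \<in> S \<longrightarrow> P t)"
  by (simp add: AE_restrict_space_iff)

lemma abs_continuous_on_diff:
  assumes f: "abs_continuous_on S f" and g: "abs_continuous_on S g"
  shows "abs_continuous_on S (\<lambda>t. f t - g t)"
  unfolding abs_continuous_on_def
proof (intro allI impI)
  fix \<epsilon> :: real assume "0 < \<epsilon>"
  then have "0 < \<epsilon> / 2" by simp
  obtain \<delta>1 where "0 < \<delta>1" and \<delta>1: "\<forall>d T. d division_of T \<and> T \<subseteq> S \<and> (\<Sum>k\<in>d. Sup k - Inf k) < \<delta>1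
      \<longrightarrow> (\<Sum>k\<in>d. \<bar>f (Sup k) - f (Inf k)\<bar>) < \<epsilon> / 2"
    using f[unfolded abs_continuous_on_def, THEN spec, THEN mp, OF \<open>0 < \<epsilon> / 2\<close>] by (elim exE conjE)
  obtain \<delta>2 where "0 < \<delta>2" and \<delta>2: "\<forall>d T. d division_of T \<and> T \<subseteq> S \<and> (\<Sum>k\<in>d. Sup k - Inf k) < \<delta>2
      \<longrightarrow> (\<Sum>k\<in>d. \<bar>g (Sup k) - g (Inf k)\<bar>) < \<epsilon> / 2"
    using g[unfolded abs_continuous_on_def, THEN spec, THEN mp, OF \<open>0 < \<epsilon> / 2\<close>] by (elim exE conjE)
  show "\<exists>\<delta>>0. \<forall>d T. d division_of T \<and> T \<subseteq> S \<and> (\<Sum>k\<in>d. Sup k - Inf k) < \<delta>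
      \<longrightarrow> (\<Sum>k\<in>d. \<bar>(f (Sup k) - g (Sup k)) - (f (Inf k) - g (Inf k))\<bar>) < \<epsilon>"
  proof (intro exI[of _ "min \<delta>1 \<delta>2"] conjI allI impI)
    fix d T assume d: "d division_of T \<and> T \<subseteq> S \<and> (\<Sum>k\<in>d. Sup k - Inf k) < min \<delta>1 \<delta>2"
    have "(\<Sum>k\<in>d. \<bar>(f (Sup k) - g (Sup k)) - (f (Inf k) - g (Inf k))\<bar>)
        \<le> (\<Sum>k\<in>d. \<bar>f (Sup k) - f (Inf k)\<bar> + \<bar>g (Sup k) - g (Inf k)\<bar>)"
      by (intro sum_mono) linarith
    also have "\<dots> = (\<Sum>k\<in>d. \<bar>f (Sup k) - f (Inf k)\<bar>) + (\<Sum>k\<in>d. \<bar>g (Sup k) - g (Inf k)\<bar>)"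
      by (rule sum.distrib)
    also have "\<dots> < \<epsilon> / 2 + \<epsilon> / 2"
      using d by (intro add_strict_mono \<delta>2[rule_format, of d T] \<delta>1[rule_format, of d T]) auto
    finally show "(\<Sum>k\<in>d. \<bar>(f (Sup k) - g (Sup k)) - (f (Inf k) - g (Inf k))\<bar>) < \<epsilon>" by simp
  qed (use \<open>0 < \<delta>1\<close> \<open>0 < \<delta>2\<close> in simp)
qed

lemma abs_continuous_on_lipschitz:
  assumes lip: "\<And>u v. a \<le> u \<Longrightarrow> u \<le> v \<Longrightarrow> v \<le> b \<Longrightarrow> \<bar>h v - h u\<bar> \<le> L * (v - u)" and "0 \<le> L"
  shows "abs_continuous_on {a..b} h"
  unfolding abs_continuous_on_def
proof (intro allI impI)
  fix \<epsilon> :: real assume "0 < \<epsilon>"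
  show "\<exists>\<delta>>0. \<forall>d T. d division_of T \<and> T \<subseteq> {a..b} \<and> (\<Sum>k\<in>d. Sup k - Inf k) < \<delta>
      \<longrightarrow> (\<Sum>k\<in>d. \<bar>h (Sup k) - h (Inf k)\<bar>) < \<epsilon>"
  proof (intro exI[of _ "\<epsilon> / (L + 1)"] conjI allI impI)
    fix d T assume d: "d division_of T \<and> T \<subseteq> {a..b} \<and> (\<Sum>k\<in>d. Sup k - Inf k) < \<epsilon> / (L + 1)"
    have each: "\<bar>h (Sup k) - h (Inf k)\<bar> \<le> L * (Sup k - Inf k) \<and> Inf k \<le> Sup k" if kd: "k \<in> d" for k
    proof -
      obtain u v where k: "k = {u..v}" and "k \<noteq> {}" "k \<subseteq> T"
        using division_ofD(2-4)[OF conjunct1[OF d] kd] by (auto simp: cbox_interval)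
      moreover have "k \<subseteq> {a..b}" using \<open>k \<subseteq> T\<close> d by blast
      ultimately have "u \<le> v" "a \<le> u" "v \<le> b" by auto
      then show ?thesis using lip[of u v] k by simp
    qed
    have "(\<Sum>k\<in>d. \<bar>h (Sup k) - h (Inf k)\<bar>) \<le> (\<Sum>k\<in>d. L * (Sup k - Inf k))"
      using each by (intro sum_mono) auto
    also have "\<dots> = L * (\<Sum>k\<in>d. Sup k - Inf k)" by (rule sum_distrib_left[symmetric])
    also have "\<dots> \<le> (L + 1) * (\<Sum>k\<in>d. Sup k - Inf k)"
      using each by (intro mult_right_mono sum_nonneg) auto
    also have "\<dots> < \<epsilon>" using d \<open>0 \<le> L\<close> by (simp add: pos_less_divide_eq mult.commute)
    finally show "(\<Sum>k\<in>d. \<bar>h (Sup k) - h (Inf k)\<bar>) < \<epsilon>" .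
  qed (use \<open>0 < \<epsilon>\<close> \<open>0 \<le> L\<close> in auto)
qed

text \<open>Choose a gauge that is fine enough for the vanishing derivative to make the increments small outside
the exceptional null set \<open>N\<close>, and that lies in a small open neighbourhood \<open>U\<close> of \<open>N\<close> at the points of
\<open>N\<close>. In a tagged division subordinate to it, the increments over intervals tagged outside \<open>N\<close> add up to
at most \<open>\<epsilon> (b - a)\<close>, and those over intervals tagged in \<open>N\<close> to at most \<open>\<epsilon>\<close> by absolute continuity,
because these intervals do not overlap and lie in \<open>U\<close>.\<close>

lemma abs_continuous_zero_derivative_constant:
  assumes ac: "abs_continuous_on {a..b} h" and "a \<le> b"
    and ae: "AE t in lebesgue_on {a..b}. (h has_real_derivative 0) (at t within {a..b})"
  shows "h b = h a"
proof -
  have "AE t in lebesgue. t \<in> {a..b} \<longrightarrow> (h has_real_derivative 0) (at t within {a..b})"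
    using ae by (simp add: AE_restrict_space_iff)
  then obtain N where N: "N \<in> null_sets lebesgue"
    and sub: "{t \<in> space lebesgue. \<not> (t \<in> {a..b} \<longrightarrow> (h has_real_derivative 0) (at t within {a..b}))} \<subseteq> N"
    unfolding eventually_ae_filter by (elim bexE)
  have der: "(h has_real_derivative 0) (at t within {a..b})" if "t \<in> {a..b}" "t \<notin> N" for t
    using sub that by auto
  have small: "\<bar>h b - h a\<bar> \<le> \<epsilon> * (b - a) + \<epsilon>" if "0 < \<epsilon>" for \<epsilon>
  proof -
    obtain \<delta> where "0 < \<delta>" and \<delta>: "\<forall>d T. d division_of T \<and> T \<subseteq> {a..b} \<and> (\<Sum>k\<in>d. Sup k - Inf k) < \<delta>
        \<longrightarrow> (\<Sum>k\<in>d. \<bar>h (Sup k) - h (Inf k)\<bar>) < \<epsilon>"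
      using ac[unfolded abs_continuous_on_def, THEN spec, THEN mp, OF \<open>0 < \<epsilon>\<close>] by (elim exE conjE)
    obtain U where U: "open U" "N \<subseteq> U" "U - N \<in> lmeasurable" "emeasure lebesgue (U - N) < ennreal \<delta>"
      using sets_lebesgue_outer_open[of N \<delta>] N \<open>0 < \<delta>\<close> by (auto simp: null_sets_def)
    have "emeasure lebesgue U = emeasure lebesgue (U - N)"
      using emeasure_Un_null_set[OF fmeasurableD[OF U(3)] N] U(2) by (simp add: Un_absorb2)
    moreover have "U \<in> lmeasurable"
    proof -
      have "N \<in> lmeasurable"
        using N by (intro negligible_imp_measurable) (simp add: negligible_iff_null_sets)
      from fmeasurable.Un[OF this U(3)] show ?thesis using U(2) by (simp add: Un_absorb1)
    qed
    ultimately have "ennreal (measure lebesgue U) < ennreal \<delta>"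
      using U(4) by (simp add: emeasure_eq_measure2)
    then have "measure lebesgue U < \<delta>" by (simp add: ennreal_less_iff)
    have "\<exists>r>0. \<forall>y\<in>{a..b}. \<bar>y - x\<bar> < r \<longrightarrow> \<bar>h y - h x\<bar> \<le> \<epsilon> * \<bar>y - x\<bar>" if "x \<in> {a..b}" "x \<notin> N" for x
      using der[OF that] \<open>0 < \<epsilon>\<close> unfolding has_field_derivative_def has_derivative_within_alt by auto
    then obtain r where r: "\<And>x. x \<in> {a..b} \<Longrightarrow> x \<notin> N \<Longrightarrow> 0 < r x"
      and hr: "\<And>x y. x \<in> {a..b} \<Longrightarrow> x \<notin> N \<Longrightarrow> y \<in> {a..b} \<Longrightarrow> \<bar>y - x\<bar> < r x \<Longrightarrow> \<bar>h y - h x\<bar> \<le> \<epsilon> * \<bar>y - x\<bar>"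
      by metis
    define \<gamma> where "\<gamma> x = (if x \<in> N then U else if x \<in> {a..b} then ball x (r x) else ball x 1)" for x
    have "gauge \<gamma>"
      using U r unfolding gauge_def \<gamma>_def by auto
    then obtain p where p: "p tagged_division_of {a..b}" "\<gamma> fine p"
      by (rule fine_division_exists_real)
    have "finite p" by (rule tagged_division_ofD(1)[OF p(1)])
    have tag: "\<exists>u v. K = {u..v} \<and> u \<le> x \<and> x \<le> v \<and> a \<le> u \<and> v \<le> b \<and> K \<subseteq> \<gamma> x" if xK: "(x, K) \<in> p" for x K
    proof -
      obtain u v where "K = {u..v}" using tagged_division_ofD(4)[OF p(1) xK] by (auto simp: cbox_interval)
      moreover have "K \<subseteq> \<gamma> x" using p(2) xK by (auto simp: fine_def)
      ultimately show ?thesis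
        using tagged_division_ofD(2,3)[OF p(1) xK] by auto
    qed
    define g where "g K = \<bar>h (Sup K) - h (Inf K)\<bar>" for K
    define p1 where "p1 = {(x, K) \<in> p. x \<in> N}"
    have "p1 \<subseteq> p" by (auto simp: p1_def)
    have "\<bar>h b - h a\<bar> = \<bar>\<Sum>(x, K)\<in>p. h (Sup K) - h (Inf K)\<bar>"
      using additive_tagged_division_1[OF \<open>a \<le> b\<close> p(1), of h] by simp
    also have "\<dots> \<le> (\<Sum>(x, K)\<in>p. g K)"
      unfolding g_def case_prod_unfold by (rule sum_abs)
    also have "\<dots> = (\<Sum>(x, K)\<in>p - p1. g K) + (\<Sum>(x, K)\<in>p1. g K)"
      by (rule sum.subset_diff[OF \<open>p1 \<subseteq> p\<close> \<open>finite p\<close>])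
    finally have split: "\<bar>h b - h a\<bar> \<le> (\<Sum>(x, K)\<in>p - p1. g K) + (\<Sum>(x, K)\<in>p1. g K)" .
    have "(\<Sum>(x, K)\<in>p - p1. g K) \<le> \<epsilon> * (b - a)"
    proof -
      have "(\<Sum>(x, K)\<in>p - p1. g K) \<le> (\<Sum>(x, K)\<in>p - p1. \<epsilon> * (Sup K - Inf K))"
      proof (rule sum_mono)
        fix xK assume "xK \<in> p - p1"
        then obtain x K where xK_eq: "xK = (x, K)" and xK: "(x, K) \<in> p" "(x, K) \<notin> p1"
          by (cases xK) auto
        obtain u v where uv: "K = {u..v}" "u \<le> x" "x \<le> v" "a \<le> u" "v \<le> b" "K \<subseteq> \<gamma> x"
          using tag[OF xK(1)] by blast
        have x: "x \<in> {a..b}" "x \<notin> N" using xK uv by (auto simp: p1_def)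
        have "{u..v} \<subseteq> ball x (r x)" "u \<in> {u..v}" "v \<in> {u..v}"
          using uv x by (auto simp: \<gamma>_def)
        then have "u \<in> ball x (r x)" "v \<in> ball x (r x)" by blast+
        then have near: "\<bar>u - x\<bar> < r x" "\<bar>v - x\<bar> < r x" by (simp_all add: dist_real_def)
        have "u \<in> {a..b}" "v \<in> {a..b}" using uv by auto
        then have "\<bar>h u - h x\<bar> \<le> \<epsilon> * \<bar>u - x\<bar>" "\<bar>h v - h x\<bar> \<le> \<epsilon> * \<bar>v - x\<bar>"
          using hr[OF x _ near(1)] hr[OF x _ near(2)] by blast+
        moreover have "\<epsilon> * \<bar>u - x\<bar> = \<epsilon> * (x - u)" "\<epsilon> * \<bar>v - x\<bar> = \<epsilon> * (v - x)" using uv by auto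
        ultimately have "\<bar>h v - h u\<bar> \<le> \<epsilon> * (x - u) + \<epsilon> * (v - x)" by linarith
        also have "\<dots> = \<epsilon> * (v - u)" by (simp add: algebra_simps)
        finally show "(case xK of (x, K) \<Rightarrow> g K) \<le> (case xK of (x, K) \<Rightarrow> \<epsilon> * (Sup K - Inf K))"
          using uv xK_eq by (simp add: g_def)
      qed
      also have "\<dots> \<le> (\<Sum>(x, K)\<in>p. \<epsilon> * (Sup K - Inf K))"
      proof (intro sum_mono2 \<open>finite p\<close>)
        fix xK assume "xK \<in> p - (p - p1)"
        then obtain x K where xK: "xK = (x, K)" "(x, K) \<in> p" by (cases xK) auto
        obtain u v where "K = {u..v}" "u \<le> v" using tag[OF xK(2)] by (auto intro: order_trans)
        then show "0 \<le> (case xK of (x, K) \<Rightarrow> \<epsilon> * (Sup K - Inf K))" using xK \<open>0 < \<epsilon>\<close> by simp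
      qed auto
      also have "\<dots> = \<epsilon> * (\<Sum>(x, K)\<in>p. Sup K - Inf K)"
        by (simp add: sum_distrib_left case_prod_unfold)
      also have "(\<Sum>(x, K)\<in>p. Sup K - Inf K) = b - a"
        using additive_tagged_division_1[OF \<open>a \<le> b\<close> p(1), of "\<lambda>x. x"] by simp
      finally show ?thesis .
    qed
    moreover have "(\<Sum>(x, K)\<in>p1. g K) \<le> \<epsilon>"
    proof -
      have p1: "p1 tagged_partial_division_of {a..b}"
        using p(1) \<open>p1 \<subseteq> p\<close> tagged_partial_division_subset unfolding tagged_division_of_def by blast
      have td: "p1 tagged_division_of \<Union>(snd ` p1)"
        by (rule tagged_partial_division_of_Union_self[OF p1])
      have div: "snd ` p1 division_of \<Union>(snd ` p1)"
        by (rule partial_division_of_tagged_division[OF p1])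
      have sub: "\<Union>(snd ` p1) \<subseteq> {a..b} \<inter> U"
      proof
        fix y assume "y \<in> \<Union>(snd ` p1)"
        then obtain x K where xK: "(x, K) \<in> p" "x \<in> N" and "y \<in> K" by (auto simp: p1_def)
        obtain u v where "K = {u..v}" "a \<le> u" "v \<le> b" "K \<subseteq> \<gamma> x" using tag[OF xK(1)] by blast
        then show "y \<in> {a..b} \<inter> U" using \<open>y \<in> K\<close> xK(2) by (auto simp: \<gamma>_def)
      qed
      have len: "Sup k - Inf k = measure lebesgue k" if k: "k \<in> snd ` p1" for k
      proof -
        obtain x where xk: "(x, k) \<in> p" using k \<open>p1 \<subseteq> p\<close> by auto
        obtain u v where "k = {u..v}" "u \<le> x" "x \<le> v" using tag[OF xk] by blast
        then show ?thesis by simp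
      qed
      have "(\<Sum>k\<in>snd ` p1. Sup k - Inf k) = (\<Sum>k\<in>snd ` p1. measure lebesgue k)"
        using len by (rule sum.cong[OF refl])
      also have "\<dots> = measure lebesgue (\<Union>(snd ` p1))"
        by (rule content_division[OF div])
      also have "\<dots> \<le> measure lebesgue U"
        using sub \<open>U \<in> lmeasurable\<close> lmeasurable_division[OF div] by (intro measure_mono_fmeasurable) auto
      finally have "(\<Sum>k\<in>snd ` p1. g k) < \<epsilon>"
        unfolding g_def using \<delta>[rule_format, of "snd ` p1"] div sub \<open>measure lebesgue U < \<delta>\<close> by auto
      moreover have "(\<Sum>(x, K)\<in>p1. g K) = (\<Sum>k\<in>snd ` p1. g k)"
      proof -
        \<comment> \<open>Two tags can share an interval only if it is a single point, on which \<open>g\<close> vanishes.\<close>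
        have "g (snd y) = 0" if y: "x \<in> p1" "y \<in> p1" "x \<noteq> y" "snd x = snd y" for x y
        proof -
          obtain x1 x2 K where xy: "x = (x1, K)" "y = (x2, K)" using y by (cases x, cases y) auto
          then have "interior K = {}"
            using tagged_division_ofD(5)[OF td, of x1 K x2 K] y by auto
          moreover obtain u v where uv: "K = {u..v}" "u \<le> x2" "x2 \<le> v"
            using tag[of x2 K] y xy \<open>p1 \<subseteq> p\<close> by auto
          ultimately have "u = v" by simp
          then show ?thesis using xy uv by (simp add: g_def)
        qed
        moreover have "finite p1" using \<open>p1 \<subseteq> p\<close> \<open>finite p\<close> by (rule finite_subset)
        ultimately have "(\<Sum>k\<in>snd ` p1. g k) = sum (g \<circ> snd) p1"
          by (intro sum.reindex_nontrivial) auto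
        then show ?thesis by (simp add: case_prod_unfold)
      qed
      ultimately show ?thesis by simp
    qed
    ultimately show ?thesis using split by linarith
  qed
  have "\<bar>h b - h a\<bar> \<le> e" if "0 < e" for e
  proof -
    have "0 < e / (b - a + 1)" using \<open>0 < e\<close> \<open>a \<le> b\<close> by simp
    from small[OF this] have "\<bar>h b - h a\<bar> \<le> e / (b - a + 1) * (b - a + 1)"
      by (simp only: distrib_left mult_1_right)
    then show ?thesis using \<open>a \<le> b\<close> by simp
  qed
  then have "\<bar>h b - h a\<bar> \<le> 0" by (rule field_le_epsilon[of _ 0, simplified])
  then show ?thesis by simp
qed

text \<open>The one-dimensional case of the differentiation theorem for averages over cubes with a corner at \<open>x\<close>.\<close>

lemma right_averages_converge_AE:
  fixes f :: "real \<Rightarrow> real"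
  assumes int: "\<And>a b. f integrable_on {a..b}"
  shows "\<exists>N. negligible N \<and> (\<forall>x e. x \<notin> N \<longrightarrow> 0 < e \<longrightarrow>
      (\<exists>d>0. \<forall>h. 0 < h \<and> h < d \<longrightarrow> \<bar>integral {x..x + h} f / h - f x\<bar> < e))"
proof -
  have "f integrable_on cbox a b" for a b using int by simp
  then obtain N where N: "negligible N" and lim: "\<And>x e. x \<notin> N \<Longrightarrow> 0 < e \<Longrightarrow> \<exists>d>0. \<forall>h. 0 < h \<and> h < d \<longrightarrow>
      norm (integral (cbox x (x + h *\<^sub>R One)) f /\<^sub>R h ^ DIM(real) - f x) < e"
    using integrable_ccontinuous_explicit by blast
  show ?thesis
  proof (intro exI[of _ N] conjI allI impI N)
    fix x e :: real assume "x \<notin> N" "0 < e"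
    then show "\<exists>d>0. \<forall>h. 0 < h \<and> h < d \<longrightarrow> \<bar>integral {x..x + h} f / h - f x\<bar> < e"
      using lim[of x e] by (simp add: divide_inverse mult.commute)
  qed
qed

text \<open>Lebesgue's differentiation theorem on the line: convergence of the right averages of \<open>f\<close>, and of the
right averages of the reflected function, which are the left averages of \<open>f\<close>.\<close>

lemma indefinite_integral_has_derivative_AE:
  fixes f :: "real \<Rightarrow> real"
  assumes int: "\<And>a b. f integrable_on {a..b}"
  shows "\<exists>N. negligible N \<and>
    (\<forall>c x. c < x \<and> x \<notin> N \<longrightarrow> ((\<lambda>t. integral {c..t} f) has_real_derivative f x) (at x))"
proof -
  obtain N1 where N1: "negligible N1" and right: "\<forall>x e. x \<notin> N1 \<longrightarrow> 0 < e \<longrightarrow>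
      (\<exists>d>0. \<forall>h. 0 < h \<and> h < d \<longrightarrow> \<bar>integral {x..x + h} f / h - f x\<bar> < e)"
    using right_averages_converge_AE[OF int] by (elim exE conjE)
  have "(\<lambda>x. f (- x)) integrable_on {a..b}" for a b
    using Henstock_Kurzweil_Integration.integrable_reflect_real[THEN iffD2, OF int, of "- a" "- b"]
    by (simp only: minus_minus)
  from right_averages_converge_AE[OF this]
  obtain N2 where N2: "negligible N2" and left: "\<forall>x e. x \<notin> N2 \<longrightarrow> 0 < e \<longrightarrow>
      (\<exists>d>0. \<forall>h. 0 < h \<and> h < d \<longrightarrow> \<bar>integral {x..x + h} (\<lambda>x. f (- x)) / h - f (- x)\<bar> < e)"
    by (elim exE conjE)
  have "negligible (uminus ` N2)"
    by (rule negligible_differentiable_image_negligible[OF order_refl N2])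
      (auto simp: differentiable_on_def intro!: derivative_intros)
  then have "negligible (N1 \<union> uminus ` N2)" using N1 by (rule negligible_Un[rotated])
  moreover have "((\<lambda>t. integral {c..t} f) has_real_derivative f x) (at x)"
    if "c < x" and x: "x \<notin> N1 \<union> uminus ` N2" for c x
  proof -
    have "x \<notin> N1" using x by simp
    have "- x \<notin> N2" using x by (metis UnI2 imageI minus_minus)
    have "(\<lambda>y. (integral {c..y} f - integral {c..x} f) / (y - x)) \<midarrow>x\<rightarrow> f x"
    proof (rule LIM_I)
      fix e :: real assume "0 < e"
      obtain d1 where d1: "0 < d1" "\<And>h. 0 < h \<Longrightarrow> h < d1 \<Longrightarrow> \<bar>integral {x..x + h} f / h - f x\<bar> < e"
        using right[rule_format, OF \<open>x \<notin> N1\<close> \<open>0 < e\<close>] by blast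
      obtain d2 where d2: "0 < d2"
        "\<And>h. 0 < h \<Longrightarrow> h < d2 \<Longrightarrow> \<bar>integral {- x..- x + h} (\<lambda>x. f (- x)) / h - f x\<bar> < e"
        using left[rule_format, OF \<open>- x \<notin> N2\<close> \<open>0 < e\<close>] by auto
      show "\<exists>d>0. \<forall>y. y \<noteq> x \<and> norm (y - x) < d \<longrightarrow>
          norm ((integral {c..y} f - integral {c..x} f) / (y - x) - f x) < e"
      proof (intro exI[of _ "min (min d1 d2) (x - c)"] conjI allI impI)
        show "0 < min (min d1 d2) (x - c)" using d1 d2 \<open>c < x\<close> by simp
        fix y assume "y \<noteq> x \<and> norm (y - x) < min (min d1 d2) (x - c)"
        then have y: "y \<noteq> x" "\<bar>y - x\<bar> < d1" "\<bar>y - x\<bar> < d2" "c < y" by auto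
        show "norm ((integral {c..y} f - integral {c..x} f) / (y - x) - f x) < e"
        proof (cases "x < y")
          case True
          have "integral {c..x} f + integral {x..y} f = integral {c..y} f"
            using True \<open>c < x\<close> int by (intro Henstock_Kurzweil_Integration.integral_combine) auto
          then have "integral {c..y} f - integral {c..x} f = integral {x..y} f" by simp
          then show ?thesis using d1(2)[of "y - x"] y True by simp
        next
          case False
          then have "y < x" using y by simp
          have "integral {c..y} f + integral {y..x} f = integral {c..x} f"
            using \<open>y < x\<close> y int by (intro Henstock_Kurzweil_Integration.integral_combine) auto
          then have "integral {c..y} f - integral {c..x} f = - integral {y..x} f" by simp
          then have "(integral {c..y} f - integral {c..x} f) / (y - x) = integral {y..x} f / (x - y)"
            by (metis minus_diff_eq minus_divide_divide)
          also have "integral {y..x} f = integral {- x..- y} (\<lambda>x. f (- x))"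
            by (rule Henstock_Kurzweil_Integration.integral_reflect_real[symmetric])
          also have "- y = - x + (x - y)" by simp
          finally have eq: "(integral {c..y} f - integral {c..x} f) / (y - x)
              = integral {- x..- x + (x - y)} (\<lambda>x. f (- x)) / (x - y)" .
          show ?thesis
            unfolding eq real_norm_def using y \<open>y < x\<close> by (intro d2(2)) auto
        qed
      qed
    qed
    then show ?thesis unfolding has_field_derivative_iff .
  qed
  ultimately show ?thesis by blast
qed

lemma loc_ac_with_derivative_unique:
  assumes f: "loc_ac_with_derivative {a..} f f'" and g: "loc_ac_with_derivative {a..} g g'"
    and eq: "\<And>s. a \<le> s \<Longrightarrow> s \<le> b \<Longrightarrow> f' s = g' s" and "a \<le> b"
  shows "f b - g b = f a - g a"
proof (rule abs_continuous_zero_derivative_constant[where h = "\<lambda>t. f t - g t"])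
  show "abs_continuous_on {a..b} (\<lambda>t. f t - g t)"
  proof (rule abs_continuous_on_diff)
    have "{a..b} \<subseteq> {a..}" by auto
    then show "abs_continuous_on {a..b} f" "abs_continuous_on {a..b} g"
      using conjunct1[OF f[unfolded loc_ac_with_derivative_def]]
        conjunct1[OF g[unfolded loc_ac_with_derivative_def]] by simp_all
  qed
  have "AE t in lebesgue. t \<in> {a..} \<longrightarrow> (f has_real_derivative f' t) (at t within {a..})"
    using conjunct2[OF f[unfolded loc_ac_with_derivative_def]] by (rule AE_lebesgue_on_iff[THEN iffD1, rotated]) simp
  moreover have "AE t in lebesgue. t \<in> {a..} \<longrightarrow> (g has_real_derivative g' t) (at t within {a..})"
    using conjunct2[OF g[unfolded loc_ac_with_derivative_def]] by (rule AE_lebesgue_on_iff[THEN iffD1, rotated]) simp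
  ultimately have "AE t in lebesgue. t \<in> {a..b} \<longrightarrow> ((\<lambda>t. f t - g t) has_real_derivative 0) (at t within {a..b})"
  proof eventually_elim
    case (elim t)
    show ?case
    proof
      assume t: "t \<in> {a..b}"
      then have "((\<lambda>t. f t - g t) has_real_derivative f' t - g' t) (at t within {a..})"
        using elim by (intro DERIV_diff) simp_all
      then have "((\<lambda>t. f t - g t) has_real_derivative f' t - g' t) (at t within {a..b})"
        by (rule DERIV_subset) auto
      then show "((\<lambda>t. f t - g t) has_real_derivative 0) (at t within {a..b})"
        using eq t by simp
    qed
  qed
  then show "AE t in lebesgue_on {a..b}. ((\<lambda>t. f t - g t) has_real_derivative 0) (at t within {a..b})"
    by (rule AE_lebesgue_on_iff[THEN iffD2, rotated]) simp
qed fact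

lemma neutral_solution_unique:
  assumes \<tau>: "0 < \<tau>" and z: "neutral_solution k1 k2 \<tau> h K z" and w: "neutral_solution k1 k2 \<tau> h K w" and "0 \<le> t"
  shows "w t = z t"
proof -
  have "z t = h t" "w t = h t" if "t \<in> {0..\<tau>}" for t
    using z w that unfolding neutral_solution_def by blast+
  then have history: "w t = z t" if "0 \<le> t" "t \<le> \<tau>" for t
    using that by simp
  have "w t = z t" if "0 \<le> t" "t \<le> real n * \<tau>" for n t
    using that
  proof (induction n arbitrary: t)
    case 0
    then show ?case using history \<tau> by simp
  next
    case (Suc n)
    show ?case
    proof (cases "t \<le> \<tau>")
      case True
      then show ?thesis using history Suc by simp
    next
      case False
      have agree: "w (s - \<tau>) = z (s - \<tau>)" if "\<tau> \<le> s" "s \<le> t" for s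
        using that Suc.prems by (intro Suc.IH) (auto simp: algebra_simps)
      have ac: "loc_ac_with_derivative {\<tau>..} (\<lambda>t. f t - k1 * f (t - \<tau>)) (\<lambda>t. k2 * f (t - \<tau>) + K t)"
        if "neutral_solution k1 k2 \<tau> h K f" for f
        using that unfolding neutral_solution_def by blast
      have "(w t - k1 * w (t - \<tau>)) - (z t - k1 * z (t - \<tau>)) = (w \<tau> - k1 * w (\<tau> - \<tau>)) - (z \<tau> - k1 * z (\<tau> - \<tau>))"
        using loc_ac_with_derivative_unique[OF ac[OF w] ac[OF z], of t] agree False by simp
      then show ?thesis
        using agree[of t] False history[of 0] history[of \<tau>] \<tau> by simp
    qed
  qed
  moreover obtain n where "t \<le> real n * \<tau>"
    using reals_Archimedean3[OF \<tau>] less_imp_le by blast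
  ultimately show ?thesis using \<open>0 \<le> t\<close> by blast
qed

section \<open>Initial history and input\<close>

lemma travel_time_bijection:
  assumes c: "continuous_on {0..1} c" "\<forall>x\<in>{0..1}. 0 < c x"
  shows "travel_time c differentiable_on {0..1}" and "inj_on (travel_time c) {0..1}"
    and "travel_time c ` {0..1} = {0..travel_time c 1}" and "0 < travel_time c 1"
proof -
  have cont: "continuous_on {0..1} (\<lambda>\<xi>. 1 / c \<xi>)"
    using c by (intro continuous_intros) auto
  have der: "(travel_time c has_real_derivative 1 / c x) (at x within {0..1})" if "x \<in> {0..1}" for x
    unfolding travel_time_def[abs_def] by (rule integral_has_real_derivative[OF cont that])
  then show diff: "travel_time c differentiable_on {0..1}"
    unfolding differentiable_on_def by (meson differentiableI has_field_derivative_imp_has_derivative)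
  then have conttt: "continuous_on {0..1} (travel_time c)"
    by (rule differentiable_imp_continuous_on)
  have less: "travel_time c x < travel_time c y" if "x < y" "x \<in> {0..1}" "y \<in> {0..1}" for x y
  proof (rule DERIV_pos_imp_increasing_open[OF \<open>x < y\<close>])
    fix z assume "x < z" "z < y"
    then have z: "0 < z" "z < 1" using that by auto
    then have "(travel_time c has_real_derivative 1 / c z) (at z)"
      using der[of z] at_within_Icc_at[of 0 z 1] by simp
    moreover have "0 < 1 / c z" using c z by simp
    ultimately show "\<exists>y. (travel_time c has_real_derivative y) (at z) \<and> 0 < y" by blast
  next
    show "continuous_on {x..y} (travel_time c)"
      by (rule continuous_on_subset[OF conttt]) (use that in auto)
  qed
  have t0: "travel_time c 0 = 0" by (simp add: travel_time_def)
  show "inj_on (travel_time c) {0..1}"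
    by (rule linorder_inj_onI) (use less in \<open>force+\<close>)
  show pos: "0 < travel_time c 1" using less[of 0 1] t0 by simp
  show "travel_time c ` {0..1} = {0..travel_time c 1}"
  proof
    have "travel_time c 0 \<le> travel_time c x \<and> travel_time c x \<le> travel_time c 1" if "x \<in> {0..1}" for x
      using less[of 0 x] less[of x 1] that by (cases "x = 0"; cases "x = 1") auto
    then show "travel_time c ` {0..1} \<subseteq> {0..travel_time c 1}" using t0 by auto
    show "{0..travel_time c 1} \<subseteq> travel_time c ` {0..1}"
    proof
      fix s assume "s \<in> {0..travel_time c 1}"
      then show "s \<in> travel_time c ` {0..1}"
        using IVT'[of "travel_time c" 0 s 1] conttt t0 by auto
    qed
  qed
qed

lemma abs_le_sup_norm:
  assumes "bounded_measurable_on {0..1} f" "x \<in> {0..1}"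
  shows "\<bar>f x\<bar> \<le> sup_norm f"
proof -
  have "bounded (f ` {0..1})" using assms by (simp add: bounded_measurable_on_def)
  then obtain B where "\<forall>x\<in>{0..1}. \<bar>f x\<bar> \<le> B" by (auto simp: bounded_iff)
  then have "bdd_above ((\<lambda>x. \<bar>f x\<bar>) ` {0..1})" by (intro bdd_aboveI[of _ B]) auto
  then show ?thesis unfolding sup_norm_def using assms(2) by (rule cSUP_upper[rotated])
qed

text \<open>Composition with a continuous inverse need not preserve Lebesgue measurability. Here the travel time
is differentiable, so it maps Lebesgue measurable sets to Lebesgue measurable sets, and these images
are the preimages under its inverse.\<close>

lemma transported_profile:
  assumes c: "continuous_on {0..1} c" "\<forall>x\<in>{0..1}. 0 < c x" and f: "bounded_measurable_on {0..1} f"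
  defines "\<psi> \<equiv> the_inv_into {0..1} (travel_time c)"
  shows "\<And>s. s \<in> {0..travel_time c 1} \<Longrightarrow> \<bar>f (\<psi> s)\<bar> \<le> sup_norm f"
    and "(\<lambda>s. f (\<psi> s)) integrable_on {0..travel_time c 1}"
proof -
  note tt = travel_time_bijection[OF c]
  have \<psi>: "\<psi> s \<in> {0..1}" "travel_time c (\<psi> s) = s" if "s \<in> {0..travel_time c 1}" for s
    using the_inv_into_into[OF tt(2), of s "{0..1}"] f_the_inv_into_f[OF tt(2), of s] that tt(3)
    by (simp_all add: \<psi>_def)
  have \<psi>': "\<psi> (travel_time c x) = x" if "x \<in> {0..1}" for x
    using the_inv_into_f_f[OF tt(2) that] by (simp add: \<psi>_def)
  show bound: "\<bar>f (\<psi> s)\<bar> \<le> sup_norm f" if "s \<in> {0..travel_time c 1}" for s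
    using abs_le_sup_norm[OF f] \<psi>[OF that] by simp
  have "(\<lambda>s. f (\<psi> s)) \<in> borel_measurable (lebesgue_on {0..travel_time c 1})"
  proof (rule measurableI)
    fix B :: "real set" assume "B \<in> sets borel"
    define A where "A = {x \<in> {0..1}. f x \<in> B}"
    have "f -` B \<inter> space (lebesgue_on {0..1}) \<in> sets (lebesgue_on {0..1})"
      using f \<open>B \<in> sets borel\<close> unfolding bounded_measurable_on_def by (intro measurable_sets) auto
    moreover have "f -` B \<inter> space (lebesgue_on {0..1}) = A"
      by (auto simp: A_def space_restrict_space)
    ultimately have "A \<in> sets lebesgue"
      by (simp add: sets_restrict_space_iff)
    moreover have "A \<subseteq> {0..1}" by (auto simp: A_def)
    ultimately have "travel_time c ` A \<in> sets lebesgue"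
      using differentiable_on_subset[OF tt(1)] by (intro differentiable_image_in_sets_lebesgue) auto
    moreover have "(\<lambda>s. f (\<psi> s)) -` B \<inter> space (lebesgue_on {0..travel_time c 1}) = travel_time c ` A"
    proof (intro equalityI subsetI)
      fix s assume "s \<in> (\<lambda>s. f (\<psi> s)) -` B \<inter> space (lebesgue_on {0..travel_time c 1})"
      then have "s \<in> {0..travel_time c 1}" "f (\<psi> s) \<in> B" by (auto simp: space_restrict_space)
      then show "s \<in> travel_time c ` A" using \<psi>[of s] by (auto simp: A_def intro!: image_eqI[of _ _ "\<psi> s"])
    next
      fix s assume "s \<in> travel_time c ` A"
      then obtain x where x: "s = travel_time c x" "x \<in> {0..1}" "f x \<in> B" by (auto simp: A_def)
      then have "s \<in> {0..travel_time c 1}" using tt(3) by blast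
      then show "s \<in> (\<lambda>s. f (\<psi> s)) -` B \<inter> space (lebesgue_on {0..travel_time c 1})"
        using x \<psi>' by (simp add: space_restrict_space)
    qed
    moreover have "travel_time c ` A \<subseteq> {0..travel_time c 1}"
      using tt(3) \<open>A \<subseteq> {0..1}\<close> by blast
    ultimately show "(\<lambda>s. f (\<psi> s)) -` B \<inter> space (lebesgue_on {0..travel_time c 1})
        \<in> sets (lebesgue_on {0..travel_time c 1})"
      by (simp add: sets_restrict_space_iff)
  qed simp
  then show "(\<lambda>s. f (\<psi> s)) integrable_on {0..travel_time c 1}"
    by (rule measurable_bounded_by_integrable_imp_integrable[OF _ integrable_const_ivl])
      (use bound in simp_all)
qed

lemma initial_history_bounded_integrable:
  assumes lam: "continuous_on {0..1} lam" "\<forall>x\<in>{0..1}. 0 < lam x"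
    and mu: "continuous_on {0..1} mu" "\<forall>x\<in>{0..1}. 0 < mu x"
    and \<alpha>: "bounded_measurable_on {0..1} \<alpha>" and \<beta>: "bounded_measurable_on {0..1} \<beta>"
    and \<tau>: "\<tau> = travel_time lam 1 + travel_time mu 1"
  shows "\<And>t. t \<in> {0..\<tau>} \<Longrightarrow> \<bar>initial_history lam mu q \<alpha> \<beta> t\<bar> \<le> (1 + \<bar>q\<bar>) * (sup_norm \<alpha> + sup_norm \<beta>)"
    and "initial_history lam mu q \<alpha> \<beta> integrable_on {0..\<tau>}"
proof -
  define \<tau>1 \<tau>2 where "\<tau>1 = travel_time lam 1" and "\<tau>2 = travel_time mu 1"
  define f g where "f s = \<alpha> (the_inv_into {0..1} (travel_time lam) s)"
    and "g s = \<beta> (the_inv_into {0..1} (travel_time mu) s)" for s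
  have h: "initial_history lam mu q \<alpha> \<beta> = (\<lambda>t. if t < \<tau>1 then f (\<tau>1 - t) else q * g (t - \<tau>1))"
    unfolding initial_history_def[abs_def] Let_def \<tau>1_def f_def g_def ..
  have f: "\<bar>f s\<bar> \<le> sup_norm \<alpha>" if "s \<in> {0..\<tau>1}" for s
    using transported_profile(1)[OF lam \<alpha>] that by (simp add: f_def \<tau>1_def)
  have g: "\<bar>g s\<bar> \<le> sup_norm \<beta>" if "s \<in> {0..\<tau>2}" for s
    using transported_profile(1)[OF mu \<beta>] that by (simp add: g_def \<tau>2_def)
  have pos: "0 < \<tau>1" "0 < \<tau>2"
    using travel_time_bijection(4)[OF lam] travel_time_bijection(4)[OF mu] by (simp_all add: \<tau>1_def \<tau>2_def)
  have nn: "0 \<le> sup_norm \<alpha>" "0 \<le> sup_norm \<beta>"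
    using f[of 0] g[of 0] pos by auto
  show "\<bar>initial_history lam mu q \<alpha> \<beta> t\<bar> \<le> (1 + \<bar>q\<bar>) * (sup_norm \<alpha> + sup_norm \<beta>)" if t: "t \<in> {0..\<tau>}" for t
  proof (cases "t < \<tau>1")
    case True
    then have "\<bar>initial_history lam mu q \<alpha> \<beta> t\<bar> \<le> 1 * (sup_norm \<alpha> + 0)"
      using f[of "\<tau>1 - t"] t unfolding h by simp
    also have "\<dots> \<le> (1 + \<bar>q\<bar>) * (sup_norm \<alpha> + sup_norm \<beta>)"
      using nn by (intro mult_mono add_mono) auto
    finally show ?thesis .
  next
    case False
    then have "\<bar>g (t - \<tau>1)\<bar> \<le> sup_norm \<beta>"
      using t \<tau> by (intro g) (auto simp: \<tau>1_def \<tau>2_def)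
    then have "\<bar>initial_history lam mu q \<alpha> \<beta> t\<bar> \<le> \<bar>q\<bar> * sup_norm \<beta>"
      using False unfolding h by (simp add: abs_mult mult_left_mono)
    also have "\<dots> \<le> (1 + \<bar>q\<bar>) * (sup_norm \<alpha> + sup_norm \<beta>)"
      using nn by (intro mult_mono) auto
    finally show ?thesis .
  qed
  have fint: "f integrable_on {0..\<tau>1}"
    using transported_profile(2)[OF lam \<alpha>] by (simp add: f_def[abs_def] \<tau>1_def)
  have "(\<lambda>t. f (t + \<tau>1)) integrable_on {0 - \<tau>1..\<tau>1 - \<tau>1}"
    by (rule integrable_shift_real_ivl[OF fint])
  then have "(\<lambda>t. f (- t + \<tau>1)) integrable_on {0..\<tau>1}"
    using Henstock_Kurzweil_Integration.integrable_reflect_real[of "\<lambda>t. f (t + \<tau>1)" 0 "- \<tau>1"] by simp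
  then have f': "(\<lambda>t. f (\<tau>1 - t)) integrable_on {0..\<tau>1}" by (simp add: add.commute)
  have "g integrable_on {0..\<tau>2}"
    using transported_profile(2)[OF mu \<beta>] by (simp add: g_def[abs_def] \<tau>2_def)
  from integrable_shift_real_ivl[OF this, of "- \<tau>1"]
  have g': "(\<lambda>t. q * g (t - \<tau>1)) integrable_on {\<tau>1..\<tau>}"
    using \<tau> by (intro integrable_on_mult_right) (simp add: \<tau>1_def \<tau>2_def add.commute)
  have "(\<lambda>t. if t \<le> \<tau>1 then f (\<tau>1 - t) else q * g (t - \<tau>1)) integrable_on {0..\<tau>}"
    using pos by (intro integrable_on_if_le f' g') auto
  then show "initial_history lam mu q \<alpha> \<beta> integrable_on {0..\<tau>}"
    by (rule integrable_spike[of _ _ "{\<tau>1}"]) (auto simp: h)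
qed

text \<open>Off a null set the function coincides with its truncation to \<open>[- M, M]\<close>, where \<open>M\<close> is its essential
supremum norm, and the truncation is bounded everywhere.\<close>

lemma Linfty_integral_bound:
  fixes K :: "real \<Rightarrow> real"
  assumes K: "in_Linfty {0<..<T} K" and uv: "0 \<le> u" "u \<le> v" "v \<le> T"
  shows "K integrable_on {u..v}" and "\<bar>integral {u..v} K\<bar> \<le> Linfty_norm {0<..<T} K * (v - u)"
proof -
  define M where "M = Linfty_norm {0<..<T} K"
  have "0 \<le> M" by (simp add: M_def Linfty_norm_def)
  have meas: "K \<in> borel_measurable (lebesgue_on {0<..<T})"
    and fin: "esssup (lebesgue_on {0<..<T}) (\<lambda>x. ennreal \<bar>K x\<bar>) < \<infinity>"
    using K by (auto simp: in_Linfty_def)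
  have ess: "esssup (lebesgue_on {0<..<T}) (\<lambda>x. ennreal \<bar>K x\<bar>) = ennreal M"
    using fin unfolding M_def Linfty_norm_def by (simp add: ennreal_enn2real_if less_top[symmetric])
  have "AE x in lebesgue_on {0<..<T}. ennreal \<bar>K x\<bar> \<le> ennreal M"
    using esssup_AE[of "\<lambda>x. ennreal \<bar>K x\<bar>" "lebesgue_on {0<..<T}"] unfolding ess .
  then have "AE x in lebesgue. x \<in> {0<..<T} \<longrightarrow> ennreal \<bar>K x\<bar> \<le> ennreal M"
    by (rule AE_lebesgue_on_iff[THEN iffD1, rotated]) simp
  then obtain N where N: "N \<in> null_sets lebesgue"
    and sub: "{x \<in> space lebesgue. \<not> (x \<in> {0<..<T} \<longrightarrow> ennreal \<bar>K x\<bar> \<le> ennreal M)} \<subseteq> N"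
    unfolding eventually_ae_filter by (elim bexE)
  have NM: "\<bar>K x\<bar> \<le> M" if "x \<in> {0<..<T}" "x \<notin> N" for x
    using sub that \<open>0 \<le> M\<close> by (auto simp: ennreal_le_iff)
  define G where "G x = max (- M) (min M (K x))" for x
  have "G \<in> borel_measurable (lebesgue_on {0<..<T})"
    unfolding G_def by (intro borel_measurable_max borel_measurable_min borel_measurable_const meas)
  moreover have "(\<lambda>_. M) integrable_on {0<..<T}"
    unfolding integrable_on_open_interval_real by (rule integrable_const_ivl)
  moreover have Gb: "norm (G x) \<le> M" for x using \<open>0 \<le> M\<close> by (auto simp: G_def)
  ultimately have "G integrable_on {0<..<T}"
    by (rule measurable_bounded_by_integrable_imp_integrable) simp
  then have "G integrable_on {0..T}"
    by (simp add: integrable_on_open_interval_real)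
  then have Gint: "G integrable_on {u..v}"
    by (rule integrable_on_subinterval) (use uv in auto)
  have neg: "negligible (N \<union> {0, T})"
    using N by (auto simp: negligible_iff_null_sets[symmetric] intro: negligible_Un)
  have eq: "K x = G x" if x: "x \<in> {u..v} - (N \<union> {0, T})" for x
  proof -
    have "\<bar>K x\<bar> \<le> M" using x uv by (intro NM) auto
    then show ?thesis by (simp add: G_def abs_le_iff)
  qed
  show "K integrable_on {u..v}"
    by (rule integrable_spike[OF Gint neg]) (use eq in auto)
  have "integral {u..v} K = integral {u..v} G"
    by (rule integral_spike[OF neg]) (use eq in auto)
  moreover have "norm (integral {u..v} G) \<le> integral {u..v} (\<lambda>_. M)"
    using Gint Gb by (intro integral_norm_bound_integral) auto
  ultimately show "\<bar>integral {u..v} K\<bar> \<le> Linfty_norm {0<..<T} K * (v - u)"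
    using uv by (simp add: M_def mult.commute)
qed

section \<open>Input-to-state stability\<close>

text \<open>The integrated equation presents \<open>z t - k1 z (t - \<tau>)\<close> as a constant plus the integral of a locally
bounded function, which is locally Lipschitz and has the integrand as derivative almost everywhere.\<close>

lemma neutral_solution_if_integral_equation:
  assumes \<tau>: "0 < \<tau>" and K: "\<forall>t>0. in_Linfty {0<..<t} K"
    and history: "\<And>t. t \<le> \<tau> \<Longrightarrow> z t = h t"
    and int: "\<And>a. z integrable_on {0..a}" and bnd: "\<And>a. bounded (z ` {0..a})"
    and eq: "\<And>T. neutral_equation_upto k1 k2 \<tau> (\<lambda>t. integral {0..t} K) T z"
  shows "neutral_solution k1 k2 \<tau> h K z"
proof -
  define D where "D t = z t - k1 * z (t - \<tau>)" for t
  define g where "g s = (if s \<in> {\<tau>..} then k2 * z (s - \<tau>) + K s else 0)" for s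
  have zshift: "(\<lambda>s. z (s - \<tau>)) integrable_on {u..v}" if "\<tau> \<le> u" for u v
  proof -
    have "z integrable_on {u - \<tau>..v - \<tau>}"
      by (rule integrable_on_subinterval[OF int[of "v - \<tau>"]]) (use that in auto)
    from integrable_shift_real_ivl[OF this, of "- \<tau>"] show ?thesis by simp
  qed
  have Kint: "K integrable_on {u..v}" if "0 \<le> u" for u v
  proof (cases "u \<le> v \<and> 0 < v")
    case True
    then show ?thesis using Linfty_integral_bound(1)[of v K u v] K that by simp
  next
    case False
    then have "{u..v} = {} \<or> {u..v} = {0}" using that by auto
    then show ?thesis using integrable_on_refl[of K 0] by (auto simp: cbox_interval)
  qed
  have gint': "(\<lambda>s. k2 * z (s - \<tau>) + K s) integrable_on {u..v}" if "\<tau> \<le> u" for u v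
    using that \<tau> by (intro integrable_add integrable_on_mult_right zshift Kint) auto
  have gint: "g integrable_on {u..v}" for u v
  proof -
    have "{\<tau>..} \<inter> {u..v} = {max \<tau> u..v}" by auto
    then show ?thesis
      using gint'[of "max \<tau> u" v] unfolding g_def integrable_restrict_Int by simp
  qed
  have D: "D t = (z \<tau> - k1 * z 0) + integral {\<tau>..t} g" if t: "\<tau> \<le> t" for t
  proof -
    have "integral {\<tau>..t} g = integral {\<tau>..t} (\<lambda>s. k2 * z (s - \<tau>) + K s)"
      by (intro integral_cong) (simp add: g_def)
    also have "\<dots> = k2 * integral {\<tau>..t} (\<lambda>s. z (s - \<tau>)) + integral {\<tau>..t} K"
      using \<tau> by (subst integral_add) (auto intro!: integrable_on_mult_right zshift Kint)
    also have "integral {\<tau>..t} (\<lambda>s. z (s - \<tau>)) = integral {0..t - \<tau>} z"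
      using integral_shift_real_ivl[of 0 "- \<tau>" "t - \<tau>" z] by simp
    also have "integral {\<tau>..t} K = integral {0..t} K - integral {0..\<tau>} K"
      using Henstock_Kurzweil_Integration.integral_combine[of 0 \<tau> t K] \<tau> t Kint by simp
    finally show ?thesis
      using eq[of t, unfolded neutral_equation_upto_def, THEN spec, of t] t unfolding D_def by linarith
  qed
  have ac: "abs_continuous_on {a..b} D" if ab: "{a..b} \<subseteq> {\<tau>..}" for a b
  proof (cases "a \<le> b")
    case True
    then have "\<tau> \<le> a" "0 < b" using ab \<tau> by auto
    obtain B where B: "\<forall>x\<in>{0..b}. \<bar>z x\<bar> \<le> B"
      using bnd[of b] by (auto simp: bounded_iff)
    have "0 \<le> B" using B \<open>0 < b\<close> by force
    show ?thesis
    proof (rule abs_continuous_on_lipschitz)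
      show "0 \<le> \<bar>k2\<bar> * B + Linfty_norm {0<..<b} K" using \<open>0 \<le> B\<close> by (simp add: Linfty_norm_def)
      fix u v assume uv: "a \<le> u" "u \<le> v" "v \<le> b"
      have "integral {\<tau>..u} g + integral {u..v} g = integral {\<tau>..v} g"
        using uv \<open>\<tau> \<le> a\<close> gint by (intro Henstock_Kurzweil_Integration.integral_combine) auto
      then have "D v - D u = integral {u..v} g"
        using D[of u] D[of v] uv \<open>\<tau> \<le> a\<close> by simp
      also have "\<dots> = integral {u..v} (\<lambda>s. k2 * z (s - \<tau>) + K s)"
        using uv \<open>\<tau> \<le> a\<close> by (intro integral_cong) (simp add: g_def)
      also have "\<dots> = k2 * integral {u..v} (\<lambda>s. z (s - \<tau>)) + integral {u..v} K"
        using uv \<open>\<tau> \<le> a\<close> \<tau> by (subst integral_add) (auto intro!: integrable_on_mult_right zshift Kint)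
      finally have Duv: "D v - D u = k2 * integral {u..v} (\<lambda>s. z (s - \<tau>)) + integral {u..v} K" .
      have "norm (integral {u..v} (\<lambda>s. z (s - \<tau>))) \<le> integral {u..v} (\<lambda>_. B)"
        using B uv \<open>\<tau> \<le> a\<close> \<tau> by (intro integral_norm_bound_integral zshift) auto
      then have "\<bar>k2\<bar> * \<bar>integral {u..v} (\<lambda>s. z (s - \<tau>))\<bar> \<le> \<bar>k2\<bar> * (B * (v - u))"
        using uv by (intro mult_left_mono) (auto simp: mult.commute)
      moreover have "\<bar>integral {u..v} K\<bar> \<le> Linfty_norm {0<..<b} K * (v - u)"
        using K \<open>0 < b\<close> uv \<open>\<tau> \<le> a\<close> \<tau> by (intro Linfty_integral_bound(2)) auto
      ultimately have "\<bar>D v - D u\<bar> \<le> \<bar>k2\<bar> * (B * (v - u)) + Linfty_norm {0<..<b} K * (v - u)"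
        unfolding Duv abs_mult[symmetric] by linarith
      then show "\<bar>D v - D u\<bar> \<le> (\<bar>k2\<bar> * B + Linfty_norm {0<..<b} K) * (v - u)"
        by (simp add: distrib_right mult.assoc)
    qed
  next
    case False
    then show ?thesis by (intro abs_continuous_on_lipschitz[where L = 0]) auto
  qed
  have ae: "AE t in lebesgue_on {\<tau>..}. (D has_real_derivative k2 * z (t - \<tau>) + K t) (at t within {\<tau>..})"
  proof -
    obtain N where N: "negligible N"
      and der: "\<forall>c x. c < x \<and> x \<notin> N \<longrightarrow> ((\<lambda>t. integral {c..t} g) has_real_derivative g x) (at x)"
      using indefinite_integral_has_derivative_AE[OF gint] by (elim exE conjE)
    have "(D has_real_derivative k2 * z (t - \<tau>) + K t) (at t within {\<tau>..})" if t: "\<tau> < t" "t \<notin> N" for t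
    proof -
      have "((\<lambda>t. (z \<tau> - k1 * z 0) + integral {\<tau>..t} g) has_real_derivative g t) (at t)"
        using DERIV_add[OF DERIV_const der[rule_format, OF conjI, OF t], of "z \<tau> - k1 * z 0"] by simp
      then have "(D has_real_derivative g t) (at t)"
        by (rule has_field_derivative_transform_within_open[of _ _ _ "{\<tau><..}"]) (use t D in auto)
      moreover have "g t = k2 * z (t - \<tau>) + K t" using t by (simp add: g_def)
      ultimately show ?thesis by (simp add: has_field_derivative_at_within)
    qed
    then have sub: "{t \<in> space lebesgue. \<not> (t \<in> {\<tau>..} \<longrightarrow>
        (D has_real_derivative k2 * z (t - \<tau>) + K t) (at t within {\<tau>..}))} \<subseteq> insert \<tau> N"
      by force
    have "insert \<tau> N \<in> null_sets lebesgue" using N by (simp add: negligible_iff_null_sets[symmetric])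
    with sub have "AE t in lebesgue. t \<in> {\<tau>..} \<longrightarrow>
        (D has_real_derivative k2 * z (t - \<tau>) + K t) (at t within {\<tau>..})"
      by (rule AE_I'[rotated])
    then show ?thesis by (rule AE_lebesgue_on_iff[THEN iffD2, rotated]) simp
  qed
  have "loc_ac_with_derivative {\<tau>..} D (\<lambda>t. k2 * z (t - \<tau>) + K t)"
    unfolding loc_ac_with_derivative_def by (intro conjI allI impI ac ae)
  then have "loc_ac_with_derivative {\<tau>..} (\<lambda>t. z t - k1 * z (t - \<tau>)) (\<lambda>t. k2 * z (t - \<tau>) + K t)"
    unfolding D_def[abs_def] .
  then show ?thesis
    unfolding neutral_solution_def by (intro conjI ballI history) simp_all
qed

text \<open>The exponential estimate is stated for inputs bounded on all of \<open>[\<tau>, \<infinity>)\<close>, whereas the bound at time \<open>t\<close>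
may involve only the norm of the input on \<open>(0, t)\<close>. For each \<open>t\<close> the input is therefore switched off
after \<open>t\<close>; by causality the solution does not change up to \<open>t\<close>.\<close>

lemma neutral_solution_bound:
  assumes k: "\<bar>k1\<bar> < 1" "k2 < 0" and \<tau>: "0 < \<tau>"
    and small: "\<bar>k2\<bar> * \<tau> < sqrt (1 - k1\<^sup>2) * arccos k1"
  shows "\<exists>C>0. \<exists>\<sigma>>0. \<forall>h K B. h integrable_on {0..\<tau>} \<and> (\<forall>t\<in>{0..\<tau>}. \<bar>h t\<bar> \<le> B) \<and> (\<forall>t>0. in_Linfty {0<..<t} K) \<longrightarrow>
    (\<exists>z. neutral_solution k1 k2 \<tau> h K z \<and> (\<forall>t\<ge>0. \<bar>z t\<bar> \<le> C * (B * exp (- \<sigma> * t) + Linfty_norm {0<..<t} K)))"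
proof -
  obtain C \<sigma> where "0 < C" "0 < \<sigma>" and bound: "\<forall>z H B \<kappa>. (\<forall>a. z integrable_on {0..a}) \<and>
       (\<forall>T. neutral_equation_upto k1 k2 \<tau> H T z) \<and> (\<forall>s\<in>{0..\<tau>}. \<bar>z s\<bar> \<le> B) \<and>
       (\<forall>s t. \<tau> \<le> s \<and> s \<le> t \<longrightarrow> \<bar>H t - H s\<bar> \<le> \<kappa> * (t - s)) \<longrightarrow>
       (\<forall>t\<ge>0. \<bar>z t\<bar> \<le> C * (B * exp (- \<sigma> * t) + \<kappa>))"
    using neutral_exponential_bound[OF k \<tau> small] by (elim exE conjE)
  have "\<exists>z. neutral_solution k1 k2 \<tau> h K z \<and> (\<forall>t\<ge>0. \<bar>z t\<bar> \<le> C * (B * exp (- \<sigma> * t) + Linfty_norm {0<..<t} K))"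
    if h: "h integrable_on {0..\<tau>}" and hB: "\<forall>t\<in>{0..\<tau>}. \<bar>h t\<bar> \<le> B" and K: "\<forall>t>0. in_Linfty {0<..<t} K"
    for h K :: "real \<Rightarrow> real" and B :: real
  proof -
    define H where "H t = integral {0..t} K" for t
    have hb: "bounded (h ` {0..\<tau>})" using hB by (auto simp: bounded_iff)
    have Hlip: "\<bar>H v - H u\<bar> \<le> Linfty_norm {0<..<T} K * (v - u)" if "0 \<le> u" "u \<le> v" "v \<le> T" "0 < T" for u v T
    proof -
      have int: "K integrable_on {0..v}" using Linfty_integral_bound(1)[of T K 0 v] K that by simp
      have "H u + integral {u..v} K = H v" unfolding H_def
        using that int by (intro Henstock_Kurzweil_Integration.integral_combine) auto
      then have "H v - H u = integral {u..v} K" by simp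
      then show ?thesis using Linfty_integral_bound(2)[of T K u v] K that by simp
    qed
    have Hcont: "continuous_on {\<tau>..} H"
    proof -
      have "isCont H t" if "\<tau> \<le> t" for t
      proof -
        have "K integrable_on {0..t + 1}"
          using Linfty_integral_bound(1)[of "t + 1" K 0 "t + 1"] K that \<tau> by simp
        then have "continuous_on {0..t + 1} H"
          unfolding H_def[abs_def] by (rule indefinite_integral_continuous_1)
        then show ?thesis
          by (rule continuous_on_interior) (use that \<tau> in auto)
      qed
      then show ?thesis by (intro continuous_at_imp_continuous_on) auto
    qed
    obtain z where zh: "\<forall>t\<le>\<tau>. z t = h t" and zint: "\<forall>a. z integrable_on {0..a}"
      and zbnd: "\<forall>a. bounded (z ` {0..a})" and zeq: "\<forall>T. neutral_equation_upto k1 k2 \<tau> H T z"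
      using neutral_equation_exists[OF \<tau> h hb Hcont, of k1 k2] by (elim exE conjE)
    have "neutral_solution k1 k2 \<tau> h K z"
      using zh zint zbnd zeq[unfolded H_def[abs_def]]
      by (intro neutral_solution_if_integral_equation[OF \<tau> K]) auto
    moreover have "\<bar>z t\<bar> \<le> C * (B * exp (- \<sigma> * t) + Linfty_norm {0<..<t} K)" if "0 \<le> t" for t
    proof -
      \<comment> \<open>The primitive of the input that is switched off at time \<open>t\<close>.\<close>
      define H' where "H' s = H (min s t)" for s
      have "continuous_on {\<tau>..} H'"
      proof (cases "\<tau> \<le> t")
        case True
        show ?thesis unfolding H'_def
          by (rule continuous_on_compose2[OF Hcont]) (use True in \<open>auto intro!: continuous_intros\<close>)
      next
        case False
        then have "H' s = H t" if "s \<in> {\<tau>..}" for s using that by (simp add: H'_def)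
        then have "continuous_on {\<tau>..} H' \<longleftrightarrow> continuous_on {\<tau>..} (\<lambda>_. H t)"
          by (intro continuous_on_cong refl)
        then show ?thesis by simp
      qed
      from neutral_equation_exists[OF \<tau> h hb this, of k1 k2]
      obtain w where wh: "\<forall>t\<le>\<tau>. w t = h t" and wint: "\<forall>a. w integrable_on {0..a}"
        and weq: "\<forall>T. neutral_equation_upto k1 k2 \<tau> H' T w" by (elim exE conjE)
      have weq_t: "neutral_equation_upto k1 k2 \<tau> H t w"
        unfolding neutral_equation_upto_def
      proof (intro allI impI)
        fix s assume s: "\<tau> \<le> s \<and> s \<le> t"
        then have "H' s = H s" "H' \<tau> = H \<tau>" by (auto simp: H'_def min_def)
        then show "w s = k1 * w (s - \<tau>) + (w \<tau> - k1 * w 0) + k2 * integral {0..s - \<tau>} w + (H s - H \<tau>)"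
          using weq[THEN spec, of t, unfolded neutral_equation_upto_def, THEN spec, THEN mp, OF s] by (simp only:)
      qed
      have wz: "w t = z t"
        using neutral_equation_unique[OF \<tau> zeq[THEN spec, of t] weq_t, of t] zh wh \<open>0 \<le> t\<close> by simp
      have lip: "\<bar>H' v - H' u\<bar> \<le> Linfty_norm {0<..<t} K * (v - u)" if "\<tau> \<le> u" "u \<le> v" for u v
      proof (cases "0 < t")
        case True
        have "\<bar>H' v - H' u\<bar> \<le> Linfty_norm {0<..<t} K * (min v t - min u t)"
          unfolding H'_def using that \<tau> True by (intro Hlip) auto
        also have "\<dots> \<le> Linfty_norm {0<..<t} K * (v - u)"
          using that by (intro mult_left_mono) (auto simp: Linfty_norm_def)
        finally show ?thesis .
      next
        case False
        then have "H' v = H' u" using that \<tau> by (simp add: H'_def)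
        then show ?thesis using that by (simp add: Linfty_norm_def)
      qed
      have wB: "\<forall>s\<in>{0..\<tau>}. \<bar>w s\<bar> \<le> B" using wh hB by auto
      have "\<forall>s t'. \<tau> \<le> s \<and> s \<le> t' \<longrightarrow> \<bar>H' t' - H' s\<bar> \<le> Linfty_norm {0<..<t} K * (t' - s)"
        using lip by blast
      from bound[THEN spec, THEN spec, THEN spec, THEN spec, THEN mp, OF conjI[OF wint conjI[OF weq conjI[OF wB this]]]]
      show ?thesis using \<open>0 \<le> t\<close> unfolding wz[symmetric] by blast
    qed
    ultimately show ?thesis by blast
  qed
  note sol = this
  show ?thesis
    by (rule exI[of _ C], intro conjI \<open>0 < C\<close>, rule exI[of _ \<sigma>], intro conjI allI impI \<open>0 < \<sigma>\<close>,
        elim conjE, rule sol)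
qed

theorem proposition1:
  fixes lam mu gam1 gam2 l1 l2 :: "real \<Rightarrow> real"
    and Kuu Kuv Kvu Kvv Laa Lab Lba Lbb :: "real \<times> real \<Rightarrow> real"
    and q \<rho> \<rho>t kI k1 k2 \<tau> :: real
  assumes "\<exists>C. C-lipschitz_on {0..1} lam" and "\<exists>C. C-lipschitz_on {0..1} mu"
    and "\<forall>x\<in>{0..1}. lam x > 0 \<and> mu x > 0"
    and "C1_unit gam1" and "C1_unit gam2"
    and "q \<noteq> 0" and "\<rho> * q < 1" and "\<bar>\<rho> * q\<bar> + \<bar>\<rho>t * q\<bar> < 1"
    and "backstepping_kernels lam mu gam1 gam2 q Kuu Kuv Kvu Kvv"
    and "inverse_kernels Kuu Kuv Kvu Kvv Laa Lab Lba Lbb"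
    and "1 + integral {0..1} (\<lambda>\<xi>. Laa (1, \<xi>)) + 1 / q * integral {0..1} (\<lambda>\<xi>. Lab (1, \<xi>)) \<noteq> 0"
    and "l_functions lam mu q Laa Lab l1 l2"
    and "k1 = (\<rho> - \<rho>t) * q"
    and "k2 = kI * q * (1 + l1 1 * lam 1)"
    and "\<tau> = integral {0..1} (\<lambda>\<xi>. 1 / lam \<xi> + 1 / mu \<xi>)"
    and "\<bar>k1\<bar> < 1" and "k2 < 0" and "0 < \<tau>" and "\<tau> < tau0 k1 k2"
  shows "\<exists>f g. class_KL f \<and> class_K g \<and>
    (\<forall>\<alpha>0 \<beta>0 K. bounded_measurable_on {0..1} \<alpha>0 \<and> bounded_measurable_on {0..1} \<beta>0 \<and>
       (\<forall>t>0. in_Linfty {0<..<t} K) \<longrightarrow>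
       (\<exists>z. neutral_solution k1 k2 \<tau> (initial_history lam mu q \<alpha>0 \<beta>0) K z \<and>
          (\<forall>w. neutral_solution k1 k2 \<tau> (initial_history lam mu q \<alpha>0 \<beta>0) K w \<longrightarrow>
             (\<forall>t\<ge>0. w t = z t)) \<and>
          (\<forall>t\<ge>0. \<bar>z t\<bar> \<le> f (sup_norm \<alpha>0 + sup_norm \<beta>0) t + g (Linfty_norm {0<..<t} K))))"
proof -
  have lam: "continuous_on {0..1} lam" "\<forall>x\<in>{0..1}. 0 < lam x"
    and mu: "continuous_on {0..1} mu" "\<forall>x\<in>{0..1}. 0 < mu x"
    using assms(1-3) lipschitz_on_continuous_on by blast+
  have "(\<lambda>\<xi>. 1 / lam \<xi>) integrable_on {0..1}" "(\<lambda>\<xi>. 1 / mu \<xi>) integrable_on {0..1}"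
    using lam mu by (auto intro!: integrable_continuous_interval continuous_intros)
  then have \<tau>: "\<tau> = travel_time lam 1 + travel_time mu 1"
    unfolding \<open>\<tau> = _\<close> travel_time_def by (rule Henstock_Kurzweil_Integration.integral_add)
  have "\<bar>k2\<bar> * \<tau> < sqrt (1 - k1\<^sup>2) * arccos k1"
  proof -
    have "0 < \<bar>k2\<bar>" using \<open>k2 < 0\<close> by simp
    from \<open>\<tau> < tau0 k1 k2\<close>[unfolded tau0_eq_arccos[OF \<open>\<bar>k1\<bar> < 1\<close>] pos_less_divide_eq[OF this]]
    show ?thesis by (simp only: mult.commute)
  qed
  from neutral_solution_bound[OF \<open>\<bar>k1\<bar> < 1\<close> \<open>k2 < 0\<close> \<open>0 < \<tau>\<close> this]
  obtain C \<sigma> where "0 < C" "0 < \<sigma>" and sol: "\<forall>h K B. h integrable_on {0..\<tau>} \<and> (\<forall>t\<in>{0..\<tau>}. \<bar>h t\<bar> \<le> B) \<and>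
      (\<forall>t>0. in_Linfty {0<..<t} K) \<longrightarrow> (\<exists>z. neutral_solution k1 k2 \<tau> h K z \<and>
        (\<forall>t\<ge>0. \<bar>z t\<bar> \<le> C * (B * exp (- \<sigma> * t) + Linfty_norm {0<..<t} K)))"
    by (elim exE conjE)
  define A where "A = C * (1 + \<bar>q\<bar>)"
  have "0 < A" using \<open>0 < C\<close> by (simp add: A_def add_pos_nonneg)
  define f where "f r t = A * exp (- \<sigma> * t) * r" for r t
  define g where "g r = C * r" for r
  have K_g: "class_K g"
    unfolding class_K_def g_def using \<open>0 < C\<close>
    by (intro conjI continuous_intros strict_mono_onI) simp_all
  have KL_f: "class_KL f"
    unfolding class_KL_def
  proof (intro conjI allI impI)
    fix t :: real
    show "class_K (\<lambda>r. f r t)"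
      unfolding class_K_def f_def using \<open>0 < A\<close>
      by (intro conjI continuous_intros strict_mono_onI) simp_all
  next
    fix r :: real assume "0 \<le> r"
    show "antimono_on {0..} (f r)"
    proof (rule monotone_onI)
      fix s t :: real assume "s \<le> t"
      then have "exp (- \<sigma> * t) \<le> exp (- \<sigma> * s)" using \<open>0 < \<sigma>\<close> by simp
      then show "f r t \<le> f r s"
        unfolding f_def using \<open>0 < A\<close> \<open>0 \<le> r\<close> by (intro mult_right_mono mult_left_mono) auto
    qed
    have "filterlim (\<lambda>t. \<sigma> * t) at_top at_top"
      by (rule filterlim_tendsto_pos_mult_at_top[OF tendsto_const \<open>0 < \<sigma>\<close> filterlim_ident])
    then have "filterlim (\<lambda>t. - (\<sigma> * t)) at_bot at_top"
      by (simp add: filterlim_uminus_at_bot)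
    then have "((\<lambda>t. exp (- (\<sigma> * t))) \<longlongrightarrow> 0) at_top"
      by (rule filterlim_compose[OF exp_at_bot])
    then have "((\<lambda>t. A * exp (- (\<sigma> * t)) * r) \<longlongrightarrow> A * 0 * r) at_top"
      by (intro tendsto_intros)
    then show "(f r \<longlongrightarrow> 0) at_top" by (simp add: f_def[abs_def])
  qed
  have iss: "\<exists>z. neutral_solution k1 k2 \<tau> (initial_history lam mu q \<alpha>0 \<beta>0) K z \<and>
          (\<forall>w. neutral_solution k1 k2 \<tau> (initial_history lam mu q \<alpha>0 \<beta>0) K w \<longrightarrow>
             (\<forall>t\<ge>0. w t = z t)) \<and>
          (\<forall>t\<ge>0. \<bar>z t\<bar> \<le> f (sup_norm \<alpha>0 + sup_norm \<beta>0) t + g (Linfty_norm {0<..<t} K))"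
    if data: "bounded_measurable_on {0..1} \<alpha>0" "bounded_measurable_on {0..1} \<beta>0" and K: "\<forall>t>0. in_Linfty {0<..<t} K"
    for \<alpha>0 \<beta>0 K
  proof -
    have hint: "initial_history lam mu q \<alpha>0 \<beta>0 integrable_on {0..\<tau>}"
      by (rule initial_history_bounded_integrable(2)[OF lam mu data \<tau>])
    have hb: "\<forall>t\<in>{0..\<tau>}. \<bar>initial_history lam mu q \<alpha>0 \<beta>0 t\<bar> \<le> (1 + \<bar>q\<bar>) * (sup_norm \<alpha>0 + sup_norm \<beta>0)"
      using initial_history_bounded_integrable(1)[OF lam mu data \<tau>] by (rule ballI)
    obtain z where z: "neutral_solution k1 k2 \<tau> (initial_history lam mu q \<alpha>0 \<beta>0) K z"
      and bound: "\<forall>t\<ge>0. \<bar>z t\<bar> \<le> C * ((1 + \<bar>q\<bar>) * (sup_norm \<alpha>0 + sup_norm \<beta>0) * exp (- \<sigma> * t)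
        + Linfty_norm {0<..<t} K)"
      using sol[THEN spec, THEN spec, THEN spec, THEN mp, OF conjI[OF hint conjI[OF hb K]]]
      by (elim exE conjE)
    have est: "\<forall>t\<ge>0. \<bar>z t\<bar> \<le> f (sup_norm \<alpha>0 + sup_norm \<beta>0) t + g (Linfty_norm {0<..<t} K)"
    proof (intro allI impI)
      fix t :: real assume "0 \<le> t"
      have "C * ((1 + \<bar>q\<bar>) * (sup_norm \<alpha>0 + sup_norm \<beta>0) * exp (- \<sigma> * t) + Linfty_norm {0<..<t} K)
          = f (sup_norm \<alpha>0 + sup_norm \<beta>0) t + g (Linfty_norm {0<..<t} K)"
        unfolding f_def g_def A_def by (subst distrib_left) (simp only: ac_simps)
      then show "\<bar>z t\<bar> \<le> f (sup_norm \<alpha>0 + sup_norm \<beta>0) t + g (Linfty_norm {0<..<t} K)"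
        using bound[THEN spec, THEN mp, OF \<open>0 \<le> t\<close>] by simp
    qed
    have uniq: "\<forall>w. neutral_solution k1 k2 \<tau> (initial_history lam mu q \<alpha>0 \<beta>0) K w \<longrightarrow> (\<forall>t\<ge>0. w t = z t)"
      by (intro allI impI neutral_solution_unique[OF \<open>0 < \<tau>\<close> z])
    show ?thesis by (rule exI[of _ z], rule conjI[OF z conjI[OF uniq est]])
  qed
  show ?thesis
    by (rule exI[of _ f], rule exI[of _ g], intro conjI allI impI KL_f K_g, elim conjE) (rule iss)
qed

end
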